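(* Let $\mathbf{k}$ be an algebraically closed field of characteristic $p>0$, let $n\geq 3$ and let $s\ge 0$ be an integer. All the algebras \[A=\mathbf{k}[T_1,\dots,T_n]/\langle T_1^{a_1},\dots,T_n^{a_n}\rangle,\qquad a_1,\dots,a_n\ge1,\] of socle degree $s=a_1+\cdots+a_n-n$ satisfy the Weak Lefschetz Property if and only if one of the following holds: \begin{enumerate} \item $s\leq 2p-2$. \item $n=3$, and $(2t+2)q-4\leq s\leq (2t+2)q-2$ for some integers $t,q$ with $1\leq t<p$ and $q=p^k\geq p$. \item $n=4$, $p=2$, and $s=6$. \end{enumerate}
   Context: The algebra $A$ is standard graded ($\deg T_i=1$), with graded pieces $A_d$. A linear form $\ell\in A_1$ is a Weak Lefschetz element if the multiplication maps $A_d\xrightarrow{\times\ell}A_{d+1}$ have maximal rank for all $d$. The algebra $A$ has the Weak Lefschetz Property (WLP) if a generic linear form $\ell\in A_1$ is a Weak Lefschetz element. *)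

theory Defs
  imports
    "HOL-Algebra.Algebra"
    "HOL-Library.Poly_Mapping"
    "HOL-Computational_Algebra.Polynomial"
begin

text \<open>
  Polynomials in the variables \<open>T\<^sub>0, T\<^sub>1, \<dots>\<close>: finitely supported maps from exponent vectors to
  coefficients. Variables are numbered from 0, so \<open>k[T\<^sub>1,\<dots>,T\<^sub>n]\<close> uses the indices \<open>{..<n}\<close>.
\<close>

type_synonym 'k mpoly = "(nat \<Rightarrow>\<^sub>0 nat) \<Rightarrow>\<^sub>0 'k"

definition Const :: "'k::comm_ring_1 \<Rightarrow> 'k mpoly" where
  "Const c = Poly_Mapping.single 0 c"

definition Var :: "nat \<Rightarrow> 'k::comm_ring_1 mpoly" where
  "Var i = Poly_Mapping.single (Poly_Mapping.single i 1) 1"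

definition mpoly_ring :: "nat \<Rightarrow> 'k::comm_ring_1 mpoly ring" where
  "mpoly_ring n =
     \<lparr>carrier = {f. \<forall>m\<in>Poly_Mapping.keys f. Poly_Mapping.keys m \<subseteq> {..<n}},
      monoid.mult = (*), one = 1, ring.zero = 0, add = (+)\<rparr>"

definition homogeneous :: "nat \<Rightarrow> 'k::comm_ring_1 mpoly \<Rightarrow> bool" where
  "homogeneous d f \<longleftrightarrow>
     (\<forall>m\<in>Poly_Mapping.keys f. (\<Sum>i\<in>Poly_Mapping.keys m. Poly_Mapping.lookup m i) = d)"

definition mpoly_eval :: "(nat \<Rightarrow> 'k) \<Rightarrow> 'k::comm_ring_1 mpoly \<Rightarrow> 'k" where
  "mpoly_eval c f =
     (\<Sum>m\<in>Poly_Mapping.keys f.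
        Poly_Mapping.lookup f m * (\<Prod>i\<in>Poly_Mapping.keys m. c i ^ Poly_Mapping.lookup m i))"


text \<open>The monomial complete intersection \<open>A = k[T\<^sub>1,\<dots>,T\<^sub>n]/\<langle>T\<^sub>1\<^sup>a\<^sup>1,\<dots>,T\<^sub>n\<^sup>a\<^sup>n\<rangle>\<close>.\<close>

definition mci_ideal :: "nat \<Rightarrow> (nat \<Rightarrow> nat) \<Rightarrow> 'k::field mpoly set" where
  "mci_ideal n a = Idl\<^bsub>mpoly_ring n\<^esub> ((\<lambda>i. Var i ^ a i) ` {..<n})"

definition mci :: "nat \<Rightarrow> (nat \<Rightarrow> nat) \<Rightarrow> 'k::field mpoly set ring" where
  "mci n a = mpoly_ring n Quot mci_ideal n a"

definition mci_class :: "nat \<Rightarrow> (nat \<Rightarrow> nat) \<Rightarrow> 'k::field mpoly \<Rightarrow> 'k mpoly set" where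
  "mci_class n a f = mci_ideal n a +>\<^bsub>mpoly_ring n\<^esub> f"

definition graded_piece :: "nat \<Rightarrow> (nat \<Rightarrow> nat) \<Rightarrow> nat \<Rightarrow> 'k::field mpoly set set" where
  "graded_piece n a d = mci_class n a ` {f \<in> carrier (mpoly_ring n). homogeneous d f}"

text \<open>
  The copy of the ground field inside \<open>A\<close>. It is a subfield as soon as all exponents are
  positive (so that \<open>A \<noteq> 0\<close>), and \<^const>\<open>ring.dim\<close> over it is the dimension over \<open>k\<close>.
\<close>

definition mci_scalars :: "nat \<Rightarrow> (nat \<Rightarrow> nat) \<Rightarrow> 'k::field mpoly set set" where
  "mci_scalars n a = mci_class n a ` range Const"

definition mci_dim :: "nat \<Rightarrow> (nat \<Rightarrow> nat) \<Rightarrow> 'k::field mpoly set set \<Rightarrow> nat" where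
  "mci_dim n a E = ring.dim (mci n a) (mci_scalars n a) E"

text \<open>\<open>A\<^sub>d \<rightarrow> A\<^sub>d\<^sub>+\<^sub>1\<close>, \<open>x \<mapsto> \<ell> x\<close>, has the largest rank that the dimensions allow.\<close>

definition mult_max_rank ::
  "nat \<Rightarrow> (nat \<Rightarrow> nat) \<Rightarrow> 'k::field mpoly set \<Rightarrow> nat \<Rightarrow> bool" where
  "mult_max_rank n a l d \<longleftrightarrow>
     mci_dim n a ((\<lambda>x. l \<otimes>\<^bsub>mci n a\<^esub> x) ` graded_piece n a d) =
     min (mci_dim n a (graded_piece n a d :: 'k mpoly set set))
         (mci_dim n a (graded_piece n a (Suc d) :: 'k mpoly set set))"

definition weak_lefschetz_element ::
  "nat \<Rightarrow> (nat \<Rightarrow> nat) \<Rightarrow> 'k::field mpoly set \<Rightarrow> bool" where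
  "weak_lefschetz_element n a l \<longleftrightarrow>
     l \<in> graded_piece n a 1 \<and> (\<forall>d. mult_max_rank n a l d)"

definition linear_form :: "nat \<Rightarrow> (nat \<Rightarrow> nat) \<Rightarrow> (nat \<Rightarrow> 'k) \<Rightarrow> 'k::field mpoly set" where
  "linear_form n a c = mci_class n a (\<Sum>i<n. Const (c i) * Var i)"

text \<open>
  Zariski-open subsets of the finite-dimensional vector space \<open>A\<^sub>1\<close>: those whose preimage under
  the linear surjection \<open>k\<^sup>n \<rightarrow> A\<^sub>1\<close>, \<open>c \<mapsto> \<Sum>\<^sub>i c\<^sub>i T\<^sub>i\<close>, is the complement of the common zero set of
  some set of polynomials. (The surjection is bijective unless some \<open>a\<^sub>i = 1\<close>. Points of \<open>k\<^sup>n\<close> are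
  functions on \<^typ>\<open>nat\<close> whose values outside \<open>{..<n}\<close> are irrelevant.)
\<close>

definition zariski_open :: "nat \<Rightarrow> (nat \<Rightarrow> nat) \<Rightarrow> 'k::field mpoly set set \<Rightarrow> bool" where
  "zariski_open n a U \<longleftrightarrow>
     U \<subseteq> graded_piece n a 1 \<and>
     (\<exists>S \<subseteq> carrier (mpoly_ring n).
        {c. linear_form n a c \<in> U} = {c. \<exists>F\<in>S. mpoly_eval c F \<noteq> 0})"

text \<open>
  ``Generic'' means: all members of some nonempty Zariski-open subset of \<open>A\<^sub>1\<close> (which is dense,
  \<open>A\<^sub>1\<close> being irreducible when the field is infinite).
\<close>

definition weak_lefschetz_property :: "'k::field itself \<Rightarrow> nat \<Rightarrow> (nat \<Rightarrow> nat) \<Rightarrow> bool" where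
  "weak_lefschetz_property _ n a \<longleftrightarrow>
     (\<exists>U :: 'k mpoly set set. zariski_open n a U \<and> U \<noteq> {} \<and>
        (\<forall>l\<in>U. weak_lefschetz_element n a l))"

end

theory Submission
  imports Defs
begin

text \<open>
  Let \<open>\<ell> = \<Sum>\<^sub>i c\<^sub>i T\<^sub>i\<close>. In the monomial basis \<open>\<ell>\<close> is an operator on functions on the box
  \<open>0 \<le> m\<^sub>i < a\<^sub>i\<close>, and the reflection \<open>m \<mapsto> a - 1 - m\<close> transposes it. Hence it has maximal rank in
  all degrees iff it is injective in all degrees \<open>d\<close> with \<open>2d + 1 \<le> s\<close>.

  Injectivity. There is an operator \<open>D\<close> with \<open>[D, \<ell>] = s - 2d\<close> in degree \<open>d\<close>. If \<open>s = 2d + 1\<close> and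
  \<open>\<ell> v = 0\<close>, it follows that \<open>\<ell> D\<^sup>j v = - j\<^sup>2 D\<^sup>j\<^sup>-\<^sup>1 v\<close>, so descending from \<open>D\<^sup>d\<^sup>+\<^sup>1 v = 0\<close> gives
  \<open>v = 0\<close> as long as \<open>d + 1 < p\<close>; smaller \<open>d\<close> reduce to this by truncating exponents. For three
  variables and \<open>d + 2 = p M\<close> the same relation shows that \<open>h = D\<^sup>p\<^sup>-\<^sup>1 v\<close> satisfies
  \<open>\<ell>\<^sup>p\<^sup>-\<^sup>1 h = u v\<close> with a unit \<open>u\<close>, so \<open>\<ell>\<^sup>p h = 0\<close>. But \<open>\<ell>\<^sup>p = \<Sum>\<^sub>i c\<^sub>i\<^sup>p T\<^sub>i\<^sup>p\<close>, and over
  \<open>k[T\<^sub>i\<^sup>p]\<close> the algebra splits, according to the residues of the exponents modulo \<open>p\<close>, into algebras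
  of the same kind, to which induction applies with \<open>M\<close> in place of \<open>p M\<close>.

  Failure. Let \<open>q = p\<^sup>k\<close> and let \<open>g(y, z)\<close> be killed by \<open>c\<^sub>1\<^sup>q y + c\<^sub>2\<^sup>q z\<close> modulo \<open>(y\<^sup>t, z\<^sup>t)\<close>. If
  \<open>a\<^sub>0 \<le> q + e\<close>, \<open>a\<^sub>1 = a\<^sub>2 = t q\<close> and the other exponents are at most \<open>q\<close>, then \<open>\<ell>\<^sup>q\<close> kills
  \<open>T\<^sub>0\<^sup>e g(T\<^sub>1\<^sup>q, T\<^sub>2\<^sup>q)\<close>, so \<open>\<ell>\<close> kills some nonzero \<open>\<ell>\<^sup>r T\<^sub>0\<^sup>e g(T\<^sub>1\<^sup>q, T\<^sub>2\<^sup>q)\<close> with \<open>r < q\<close>.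
\<close>

section \<open>Multiplication by a linear form on coefficient functions\<close>

definition box :: "'i set \<Rightarrow> ('i \<Rightarrow> nat) \<Rightarrow> nat \<Rightarrow> ('i \<Rightarrow> nat) set" where
  "box I a d = {m. (\<forall>i\<in>I. m i < a i) \<and> (\<forall>i. i \<notin> I \<longrightarrow> m i = 0) \<and> sum m I = d}"

text \<open>The coefficient of \<open>(\<Sum>\<^sub>i c\<^sub>i T\<^sub>i\<^sup>r) f\<close> at \<open>m\<close>, where \<open>f\<close> has coefficients \<open>v\<close>.\<close>

definition shift :: "'i set \<Rightarrow> ('i \<Rightarrow> 'k) \<Rightarrow> nat \<Rightarrow> (('i \<Rightarrow> nat) \<Rightarrow> 'k) \<Rightarrow> ('i \<Rightarrow> nat) \<Rightarrow> 'k::field" where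
  "shift I c r v m = (\<Sum>i\<in>I. if r \<le> m i then c i * v (m(i := m i - r)) else 0)"

text \<open>
  The operator \<open>D\<close>. Its weight vanishes when \<open>m\<^sub>i + 1 = a\<^sub>i\<close>, so values of \<open>v\<close> outside the box never
  enter.
\<close>

definition lower :: "'i set \<Rightarrow> ('i \<Rightarrow> nat) \<Rightarrow> ('i \<Rightarrow> 'k) \<Rightarrow> (('i \<Rightarrow> nat) \<Rightarrow> 'k) \<Rightarrow> ('i \<Rightarrow> nat) \<Rightarrow> 'k::field" where
  "lower I a c v m =
     (\<Sum>i\<in>I. inverse (c i) * of_nat (Suc (m i) * (a i - Suc (m i))) * v (m(i := Suc (m i))))"

text \<open>
  \<open>v\<close> ranges over all functions, but only its values on \<open>box I a d\<close> matter on either side.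
\<close>

definition lef_inj :: "'i set \<Rightarrow> ('i \<Rightarrow> nat) \<Rightarrow> ('i \<Rightarrow> 'k::field) \<Rightarrow> nat \<Rightarrow> bool" where
  "lef_inj I a c d \<longleftrightarrow>
     (\<forall>v. (\<forall>m\<in>box I a (Suc d). shift I c 1 v m = 0) \<longrightarrow> (\<forall>m\<in>box I a d. v m = 0))"

lemma lef_injI:
  assumes "\<And>v m. (\<And>m. m \<in> box I a (Suc d) \<Longrightarrow> shift I c 1 v m = 0) \<Longrightarrow> m \<in> box I a d \<Longrightarrow> v m = 0"
  shows "lef_inj I a c d"
  using assms unfolding lef_inj_def by blast

lemma lef_injD:
  assumes "lef_inj I a c d" "\<And>m. m \<in> box I a (Suc d) \<Longrightarrow> shift I c 1 v m = 0" "m \<in> box I a d"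
  shows "v m = 0"
  using assms unfolding lef_inj_def by blast

section \<open>Boxes of exponents and elementary rules for the two operators\<close>

lemma sum_fun_upd:
  fixes m :: "'i \<Rightarrow> nat"
  assumes "finite I" "i \<in> I"
  shows "sum (m(i := x)) I + m i = sum m I + x"
proof -
  have "sum (m(i := x)) I = x + sum (m(i := x)) (I - {i})"
    using assms by (simp add: sum.remove)
  also have "sum (m(i := x)) (I - {i}) = sum m (I - {i})"
    by (rule sum.cong) auto
  finally show ?thesis
    using assms by (simp add: sum.remove)
qed

lemma sum_pred:
  fixes a :: "'i \<Rightarrow> nat"
  assumes "\<And>i. i \<in> I \<Longrightarrow> 1 \<le> a i"
  shows "(\<Sum>i\<in>I. a i - 1) + card I = sum a I"
proof -
  have "(\<Sum>i\<in>I. a i - 1) + (\<Sum>i\<in>I. 1) = (\<Sum>i\<in>I. a i - 1 + 1)"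
    by (rule sum.distrib[symmetric])
  also have "\<dots> = sum a I" using assms by (intro sum.cong refl) (metis le_add_diff_inverse2)
  finally show ?thesis by simp
qed

lemma box_down:
  assumes "finite I" "i \<in> I" "m \<in> box I a (d + r)" "r \<le> m i"
  shows "m(i := m i - r) \<in> box I a d"
proof -
  have "sum (m(i := m i - r)) I = d"
    using sum_fun_upd[OF assms(1,2), of m "m i - r"] assms(3,4) unfolding box_def by simp
  then show ?thesis
    using assms less_imp_diff_less unfolding box_def by force
qed

lemma box_up:
  assumes "finite I" "i \<in> I" "m \<in> box I a d" "m i + r < a i"
  shows "m(i := m i + r) \<in> box I a (d + r)"
proof -
  have "sum (m(i := m i + r)) I = d + r"
    using sum_fun_upd[OF assms(1,2), of m "m i + r"] assms(3,4) unfolding box_def by simp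
  then show ?thesis
    using assms unfolding box_def by auto
qed

lemma shift_cong:
  assumes "finite I" "m \<in> box I a (d + r)" "\<And>m. m \<in> box I a d \<Longrightarrow> v m = w m"
  shows "shift I c r v m = shift I c r w m"
  unfolding shift_def using assms box_down[OF assms(1)] by (intro sum.cong) auto

lemma lower_cong:
  assumes "finite I" "m \<in> box I a d" "\<And>m. m \<in> box I a (Suc d) \<Longrightarrow> v m = w m"
  shows "lower I a c v m = lower I a c w m"
  unfolding lower_def
proof (intro sum.cong refl)
  fix i assume "i \<in> I"
  show "inverse (c i) * of_nat (Suc (m i) * (a i - Suc (m i))) * v (m(i := Suc (m i))) =
        inverse (c i) * of_nat (Suc (m i) * (a i - Suc (m i))) * w (m(i := Suc (m i)))"
  proof (cases "Suc (m i) < a i")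
    case True
    then show ?thesis
      using box_up[OF assms(1) \<open>i \<in> I\<close> assms(2), of 1] assms(3) by simp
  qed simp
qed

lemma shift_lincomb:
  "shift I c r (\<lambda>m. x * v m + y * w m) m = x * shift I c r v m + y * shift I c r w m"
  unfolding shift_def sum_distrib_left sum.distrib[symmetric]
  by (intro sum.cong) (auto simp: algebra_simps)

lemma shift_smult: "shift I c r (\<lambda>m. x * v m) m = x * shift I c r v m"
  using shift_lincomb[of I c r x v 0 v m] by simp

lemma shift_zero [simp]: "shift I c r (\<lambda>m. 0) m = 0"
  unfolding shift_def by (intro sum.neutral) simp

lemma lower_smult: "lower I a c (\<lambda>m. x * v m) m = x * lower I a c v m"
  unfolding lower_def sum_distrib_left by (intro sum.cong) (auto simp: algebra_simps)

lemma lower_zero [simp]: "lower I a c (\<lambda>m. 0) m = 0"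
  by (simp add: lower_def)

text \<open>An sl_2 relation for the tensor product of the algebras k[T_i]/(T_i^{a_i}). Different
  variables commute; a single one contributes (m+1)(a-m-1) - m(a-m) = a-1-2m, and the inverse in
  \<open>lower\<close> cancels the c_i coming from \<open>shift\<close>.\<close>

lemma commutator:
  fixes c :: "'i \<Rightarrow> 'k::field"
  assumes fin: "finite I" and c: "\<And>i. i \<in> I \<Longrightarrow> c i \<noteq> 0" and m: "m \<in> box I a d"
  shows "lower I a c (shift I c 1 v) m - shift I c 1 (lower I a c v) m
    = (of_nat (\<Sum>i\<in>I. a i - 1) - 2 * of_nat d) * v m"
proof -
  define T where "T i j = inverse (c i) * of_nat (Suc (m i) * (a i - Suc (m i))) *
      (if 1 \<le> (m(i := Suc (m i))) j
       then c j * v ((m(i := Suc (m i)))(j := (m(i := Suc (m i))) j - 1)) else 0)" for i j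
  define U where "U i j = (if 1 \<le> m j then c j * (inverse (c i) *
      of_nat (Suc ((m(j := m j - 1)) i) * (a i - Suc ((m(j := m j - 1)) i))) *
      v ((m(j := m j - 1))(i := Suc ((m(j := m j - 1)) i)))) else 0)" for i j
  have off: "T i j - U i j = 0" if "i \<noteq> j" for i j
    using that unfolding T_def U_def by (simp add: fun_upd_twist)
  have diag: "T i i - U i i = (of_nat (a i - 1) - 2 * of_nat (m i)) * v m" if "i \<in> I" for i
  proof -
    have "m i < a i" using m that unfolding box_def by auto
    then obtain b where b: "a i = Suc (m i + b)" using less_iff_Suc_add by auto
    show ?thesis
      using c[OF that] unfolding T_def U_def b
      by (cases "m i") (auto simp: fun_upd_idem field_simps)
  qed
  have "lower I a c (shift I c 1 v) m - shift I c 1 (lower I a c v) m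
      = (\<Sum>i\<in>I. \<Sum>j\<in>I. T i j) - (\<Sum>j\<in>I. \<Sum>i\<in>I. U i j)"
    unfolding lower_def shift_def T_def U_def sum_distrib_left
    by (intro arg_cong2[of _ _ _ _ "(-)"] sum.cong refl) auto
  also have "(\<Sum>j\<in>I. \<Sum>i\<in>I. U i j) = (\<Sum>i\<in>I. \<Sum>j\<in>I. U i j)"
    by (rule sum.swap)
  also have "(\<Sum>i\<in>I. \<Sum>j\<in>I. T i j) - (\<Sum>i\<in>I. \<Sum>j\<in>I. U i j) = (\<Sum>i\<in>I. \<Sum>j\<in>I. T i j - U i j)"
    by (simp add: sum_subtractf)
  also have "\<dots> = (\<Sum>i\<in>I. \<Sum>j\<in>I. if i = j then (of_nat (a i - 1) - 2 * of_nat (m i)) * v m else 0)"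
    using off diag by (intro sum.cong) auto
  also have "\<dots> = (\<Sum>i\<in>I. (of_nat (a i - 1) - 2 * of_nat (m i)) * v m)"
    using fin by (intro sum.cong) auto
  also have "\<dots> = (of_nat (\<Sum>i\<in>I. a i - 1) - 2 * of_nat d) * v m"
    using m unfolding box_def
    by (auto simp: sum_distrib_right[symmetric] sum_subtractf sum_distrib_left[symmetric])
  finally show ?thesis .
qed

text \<open>The weight in degree d - j is s - 2(d - j) = 2j + 1. Starting from a kernel element, the
  weights add up to 1 + 3 + ... + (2j+1) = (j+1)^2, which is the factor that appears.\<close>

lemma raise_lower_power:
  fixes c :: "'i \<Rightarrow> 'k::field"
  assumes fin: "finite I" and c: "\<And>i. i \<in> I \<Longrightarrow> c i \<noteq> 0"
    and s: "(\<Sum>i\<in>I. a i - 1) = 2 * d + 1"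
    and v: "\<And>m. m \<in> box I a (Suc d) \<Longrightarrow> shift I c 1 v m = 0"
    and "j \<le> d" "m \<in> box I a (d - j)"
  shows "shift I c 1 ((lower I a c ^^ Suc j) v) m = - (of_nat (Suc j))\<^sup>2 * (lower I a c ^^ j) v m"
  using assms(5,6)
proof (induction j arbitrary: m)
  case 0
  have "lower I a c (shift I c 1 v) m = lower I a c (\<lambda>_. 0) m"
    using 0 v by (intro lower_cong[OF fin]) auto
  moreover have "lower I a c (shift I c 1 v) m - shift I c 1 (lower I a c v) m = v m"
    using 0 commutator[OF fin c, where m = m and a = a and d = d and v = v] unfolding s by simp
  ultimately have "v m = - shift I c 1 (lower I a c v) m" by simp
  then show ?case by simp
next
  case (Suc j)
  let ?w = "(lower I a c ^^ Suc j) v"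
  have "lower I a c (shift I c 1 ?w) m = lower I a c (\<lambda>m. - (of_nat (Suc j))\<^sup>2 * (lower I a c ^^ j) v m) m"
    using Suc by (intro lower_cong[OF fin, of _ _ "d - Suc j"]) (auto simp: Suc_diff_Suc)
  also have "\<dots> = - (of_nat (Suc j))\<^sup>2 * ?w m"
    by (subst lower_smult) simp
  finally have 1: "lower I a c (shift I c 1 ?w) m = - (of_nat (Suc j))\<^sup>2 * ?w m" .
  \<comment> \<open>Truncated subtraction is replaced by an addition before passing to the
    field.\<close>
  have 2: "of_nat d = (of_nat (d - Suc j) + of_nat (Suc j) :: 'k)"
    using Suc.prems(1) by (subst of_nat_add[symmetric]) simp
  have "lower I a c (shift I c 1 ?w) m - shift I c 1 (lower I a c ?w) m
      = (of_nat (2 * d + 1) - 2 * of_nat (d - Suc j)) * ?w m"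
    unfolding s[symmetric] by (rule commutator[OF fin c Suc.prems(2)])
  moreover have "(of_nat (2 * d + 1) - 2 * of_nat (d - Suc j) :: 'k) = 2 * of_nat (Suc j) + 1"
    by (simp add: 2 algebra_simps)
  ultimately have "- (of_nat (Suc j))\<^sup>2 * ?w m - shift I c 1 (lower I a c ?w) m = (2 * of_nat (Suc j) + 1) * ?w m"
    unfolding 1 by (simp only:)
  then have "shift I c 1 (lower I a c ?w) m
      = (- (of_nat (Suc j))\<^sup>2 - (2 * of_nat (Suc j) + 1)) * ?w m"
    by (simp only: diff_eq_eq left_diff_distrib) (simp only: add.commute add_diff_cancel_right')
  also have "\<dots> = - (of_nat (Suc (Suc j)))\<^sup>2 * ?w m"
    by (simp add: power2_eq_square algebra_simps)
  finally show ?case by simp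
qed

section \<open>Reductions between boxes and degrees\<close>

lemma box_below_socle:
  assumes "m \<in> box I a d" "d < (\<Sum>i\<in>I. a i - 1)"
  shows "\<exists>i\<in>I. m i < a i - 1"
proof (rule ccontr)
  assume "\<not> ?thesis"
  then have "(\<Sum>i\<in>I. a i - 1) \<le> sum m I" by (intro sum_mono) force
  with assms show False unfolding box_def by simp
qed

text \<open>A kernel element stays one modulo T_i^{a_i - 1}, because \<open>shift\<close> only looks
  at smaller exponents. Below the socle degree, every monomial survives in one of these
  quotients.\<close>

lemma lef_inj_quotient:
  assumes fin: "finite I" and a: "\<And>i. i \<in> I \<Longrightarrow> 1 \<le> a i"
    and d: "d < (\<Sum>i\<in>I. a i - 1)"
    and inj: "\<And>i. i \<in> I \<Longrightarrow> 2 \<le> a i \<Longrightarrow> lef_inj I (a(i := a i - 1)) c d"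
  shows "lef_inj I a c d"
proof (rule lef_injI)
  fix v m assume v: "\<And>m. m \<in> box I a (Suc d) \<Longrightarrow> shift I c 1 v m = 0" and m: "m \<in> box I a d"
  obtain i where i: "i \<in> I" "m i < a i - 1"
    using box_below_socle[OF m d] by blast
  show "v m = 0"
  proof (rule lef_injD[OF inj[OF i(1)]])
    show "2 \<le> a i" using i by simp
    show "m \<in> box I (a(i := a i - 1)) d" using m i unfolding box_def by auto
    fix m' assume "m' \<in> box I (a(i := a i - 1)) (Suc d)"
    then have "m' \<in> box I a (Suc d)"
      using i unfolding box_def by (auto split: if_splits)
    then show "shift I c 1 v m' = 0" by (rule v)
  qed
qed

lemma shift_single_commute:
  assumes "i \<in> I"
  shows "shift I c 1 (\<lambda>m. if 1 \<le> m i then v (m(i := m i - 1)) else 0) m =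
    (if 1 \<le> m i then shift I c 1 v (m(i := m i - 1)) else 0)"
proof -
  have "(if 1 \<le> m j then c j * (if 1 \<le> (m(j := m j - 1)) i
            then v ((m(j := m j - 1))(i := (m(j := m j - 1)) i - 1)) else 0) else 0)
      = (if 1 \<le> m i then if 1 \<le> (m(i := m i - 1)) j
            then c j * v ((m(i := m i - 1))(j := (m(i := m i - 1)) j - 1)) else 0 else 0)" for j
    by (cases "i = j") (auto simp: fun_upd_twist)
  then show ?thesis
    unfolding shift_def by (auto intro!: sum.cong)
qed

text \<open>Multiplication by T_i embeds the algebra, shifted by one degree, into the one with a_i
  enlarged by one, and it commutes with the linear form.\<close>

lemma lef_inj_embed:
  assumes fin: "finite I" and i: "i \<in> I" and inj: "lef_inj I (a(i := Suc (a i))) c (Suc d)"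
  shows "lef_inj I a c d"
proof (rule lef_injI)
  fix v m assume v: "\<And>m. m \<in> box I a (Suc d) \<Longrightarrow> shift I c 1 v m = 0" and m: "m \<in> box I a d"
  define w where "w = (\<lambda>m. if 1 \<le> m i then v (m(i := m i - 1)) else 0)"
  have "w (m(i := m i + 1)) = 0"
  proof (rule lef_injD[OF inj])
    have "m \<in> box I (a(i := Suc (a i))) d" using m unfolding box_def by auto
    then show "m(i := m i + 1) \<in> box I (a(i := Suc (a i))) (Suc d)"
      using box_up[OF fin i, of m "a(i := Suc (a i))" d 1] m i unfolding box_def by simp
    fix m' assume m': "m' \<in> box I (a(i := Suc (a i))) (Suc (Suc d))"
    have "m'(i := m' i - 1) \<in> box I a (Suc d)" if "1 \<le> m' i"
      using box_down[OF fin i, of m' "a(i := Suc (a i))" "Suc d" 1] m' that i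
      unfolding box_def by (auto split: if_splits)
    then show "shift I c 1 w m' = 0"
      unfolding w_def shift_single_commute[OF i] using v by auto
  qed
  then show "v m = 0" by (simp add: w_def)
qed

text \<open>A kernel element times T_i is a kernel element one degree higher. Below the socle
  degree, each monomial has a T_i whose product with it is nonzero, so its coefficient can be read
  off there.\<close>

lemma lef_inj_pred:
  assumes fin: "finite I" and d: "d < (\<Sum>i\<in>I. a i - 1)" and inj: "lef_inj I a c (Suc d)"
  shows "lef_inj I a c d"
proof (rule lef_injI)
  fix v m assume v: "\<And>m. m \<in> box I a (Suc d) \<Longrightarrow> shift I c 1 v m = 0" and m: "m \<in> box I a d"
  obtain i where i: "i \<in> I" "m i < a i - 1"
    using box_below_socle[OF m d] by blast
  define w where "w = (\<lambda>m. if 1 \<le> m i then v (m(i := m i - 1)) else 0)"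
  have "w (m(i := m i + 1)) = 0"
  proof (rule lef_injD[OF inj])
    show "m(i := m i + 1) \<in> box I a (Suc d)"
      using box_up[OF fin i(1) m, of 1] i by simp
    fix m' assume m': "m' \<in> box I a (Suc (Suc d))"
    show "shift I c 1 w m' = 0"
      unfolding w_def shift_single_commute[OF i(1)]
      using v box_down[OF fin i(1), of m' a "Suc d" 1] m' by auto
  qed
  then show "v m = 0" by (simp add: w_def)
qed

lemma lef_inj_downward:
  assumes "finite I" "lef_inj I a c d" "d \<le> (\<Sum>i\<in>I. a i - 1)" "e \<le> d"
  shows "lef_inj I a c e"
  using assms(4,2)
proof (induction e rule: inc_induct)
  case (step e)
  then show ?case using lef_inj_pred[OF assms(1), of e a c] assms(3) by simp
qed

lemma lef_inj_char_large:
  fixes c :: "'i \<Rightarrow> 'k::field"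
  assumes fin: "finite I" and c: "\<And>i. i \<in> I \<Longrightarrow> c i \<noteq> 0"
    and unit: "\<And>j. 1 \<le> j \<Longrightarrow> j \<le> Suc d \<Longrightarrow> of_nat j \<noteq> (0::'k)"
    and "\<And>i. i \<in> I \<Longrightarrow> 1 \<le> a i" "2 * d + 1 \<le> (\<Sum>i\<in>I. a i - 1)"
  shows "lef_inj I a c d"
  using assms(4,5)
proof (induction "\<Sum>i\<in>I. a i - 1" arbitrary: a rule: less_induct)
  case less
  show ?case
  proof (cases "(\<Sum>i\<in>I. a i - 1) = 2 * d + 1")
    case True
    show ?thesis
    proof (rule lef_injI)
      fix v m assume v: "\<And>m. m \<in> box I a (Suc d) \<Longrightarrow> shift I c 1 v m = 0" and m: "m \<in> box I a d"
      have "\<forall>m\<in>box I a (d - j). (lower I a c ^^ j) v m = 0" if "j \<le> d" for j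
        using that
      proof (induction j rule: inc_induct)
        \<comment> \<open>In degree 0 no exponent can be lowered, so \<open>shift\<close> is an
          empty contribution; this plays the part of D^{d+1} v = 0.\<close>
        case base
        show ?case
        proof
          fix m assume m: "m \<in> box I a (d - d)"
          then have "m i = 0" if "i \<in> I" for i
            using that fin unfolding box_def by auto
          then have "shift I c 1 ((lower I a c ^^ Suc d) v) m = 0"
            unfolding shift_def by (intro sum.neutral) auto
          then show "(lower I a c ^^ d) v m = 0"
            using raise_lower_power[OF fin c True v _ m] unit[of "Suc d"] by simp
        qed
      next
        case (step j)
        show ?case
        proof
          fix m assume m: "m \<in> box I a (d - j)"
          have "shift I c 1 ((lower I a c ^^ Suc j) v) m = shift I c 1 (\<lambda>_. 0) m"
            using step m by (intro shift_cong[OF fin, of _ _ "d - Suc j"]) (auto simp: Suc_diff_Suc)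
          then show "(lower I a c ^^ j) v m = 0"
            using raise_lower_power[OF fin c True v _ m] unit[of "Suc j"] step.hyps by simp
        qed
      qed
      from this[of 0] show "v m = 0" using m by simp
    qed
  next
    case False
    \<comment> \<open>Here s > 2d + 1, so lowering one exponent by one keeps the inequality and
      decreases s.\<close>
    show ?thesis
    proof (rule lef_inj_quotient[OF fin less.prems(1)])
      show "d < (\<Sum>i\<in>I. a i - 1)" using less.prems by simp
      fix i assume i: "i \<in> I" "2 \<le> a i"
      have *: "(\<Sum>j\<in>I. (a(i := a i - 1)) j - 1) + 1 = (\<Sum>j\<in>I. a j - 1)"
        using sum.remove[OF fin i(1), of "\<lambda>j. a j - 1"]
          sum.remove[OF fin i(1), of "\<lambda>j. (a(i := a i - 1)) j - 1"] i
        by (auto intro!: sum.cong)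
      show "lef_inj I (a(i := a i - 1)) c d"
        using * False less.prems i by (intro less.hyps) auto
    qed
  qed
qed

section \<open>Frobenius descent\<close>

lemma shift_sum:
  "shift I c r (\<lambda>m. \<Sum>k\<in>A. x k * v k m) m = (\<Sum>k\<in>A. x k * shift I c r (v k) m)"
proof (induction A rule: infinite_finite_induct)
  case (insert k A)
  then show ?case
    using shift_lincomb[of I c r "x k" "v k" 1 "\<lambda>m. \<Sum>k\<in>A. x k * v k m"] by simp
qed simp_all

lemma shift_shift_commute:
  assumes "finite I" "finite J"
  shows "shift I c r (shift J c' r' v) = shift J c' r' (shift I c r v)"
proof
  fix m
  have "(if r \<le> m i then c i * (if r' \<le> (m(i := m i - r)) j
            then c' j * v ((m(i := m i - r))(j := (m(i := m i - r)) j - r')) else 0) else 0)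
      = (if r' \<le> m j then c' j * (if r \<le> (m(j := m j - r')) i
            then c i * v ((m(j := m j - r'))(i := (m(j := m j - r')) i - r)) else 0) else 0)" for i j
    by (cases "i = j") (auto simp: fun_upd_twist add.commute)
  then have "(\<Sum>i\<in>I. \<Sum>j\<in>J. if r \<le> m i then c i * (if r' \<le> (m(i := m i - r)) j
            then c' j * v ((m(i := m i - r))(j := (m(i := m i - r)) j - r')) else 0) else 0)
      = (\<Sum>j\<in>J. \<Sum>i\<in>I. if r' \<le> m j then c' j * (if r \<le> (m(j := m j - r')) i
            then c i * v ((m(j := m j - r'))(i := (m(j := m j - r')) i - r)) else 0) else 0)"
    by (subst sum.swap) simp
  moreover have e: "shift I c r (shift J c' r' v) m = (\<Sum>i\<in>I. \<Sum>j\<in>J. if r \<le> m i then c i * (if r' \<le> (m(i := m i - r)) j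
            then c' j * v ((m(i := m i - r))(j := (m(i := m i - r)) j - r')) else 0) else 0)"
    for I J c r c' r' v
    unfolding shift_def by (intro sum.cong refl) (auto simp: sum_distrib_left)
  ultimately show "shift I c r (shift J c' r' v) m = shift J c' r' (shift I c r v) m"
    unfolding e[of I c r J c' r' v] e[of J c' r' I c r v] by simp
qed

lemma shift_pow_add:
  "(shift I c r ^^ n) (\<lambda>m. v m + w m) = (\<lambda>m. (shift I c r ^^ n) v m + (shift I c r ^^ n) w m)"
proof (induction n)
  case (Suc n)
  then show ?case using shift_lincomb[of I c r 1 _ 1] by auto
qed simp

lemma shift_pow_commute:
  assumes "finite I" "finite J"
  shows "(shift I c r ^^ n) (shift J c' r' v) = shift J c' r' ((shift I c r ^^ n) v)"
  by (induction n) (simp_all add: shift_shift_commute[OF assms])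

text \<open>The binomial theorem for two commuting operators: the part in T_i and the part in the
  remaining variables.\<close>

lemma binomial_shift_insert:
  fixes c :: "'i \<Rightarrow> 'k::field"
  assumes fin: "finite I" and i: "i \<notin> I"
  shows "(shift (insert i I) c r ^^ n) v =
    (\<lambda>m. \<Sum>k\<le>n. of_nat (n choose k) * (shift {i} c r ^^ k) ((shift I c r ^^ (n - k)) v) m)"
proof (induction n arbitrary: v)
  case (Suc n)
  let ?A = "shift {i} c r" and ?B = "shift I c r"
  have AB: "shift (insert i I) c r v = (\<lambda>m. ?A v m + ?B v m)"
    unfolding shift_def using fin i by auto
  define f where "f k = (?A ^^ k) ((?B ^^ (Suc n - k)) v)" for k
  have *: "(?A ^^ k) ((?B ^^ (n - k)) (\<lambda>m. ?A v m + ?B v m)) m = f (Suc k) m + f k m" if "k \<le> n" for k m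
  proof -
    have "(?A ^^ k) ((?B ^^ (n - k)) (?A v)) = f (Suc k)"
      unfolding f_def by (simp only: shift_pow_commute[OF fin finite.insertI[OF finite.emptyI]]
          funpow_Suc_right o_apply diff_Suc_Suc)
    moreover have "(?A ^^ k) ((?B ^^ (n - k)) (?B v)) = f k"
      unfolding f_def using that by (simp only: Suc_diff_le funpow_Suc_right o_apply)
    ultimately show ?thesis by (simp add: shift_pow_add)
  qed
  have "(\<Sum>k\<le>n. of_nat (n choose k) * (f (Suc k) m + f k m))
      = (\<Sum>k\<le>Suc n. of_nat (Suc n choose k) * f k m)" for m
  proof -
    have "(\<Sum>k\<le>Suc n. of_nat (Suc n choose k) * f k m)
        = f 0 m + (\<Sum>k\<le>n. of_nat (Suc n choose Suc k) * f (Suc k) m)"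
      by (subst sum.atMost_Suc_shift) simp
    also have "(\<Sum>k\<le>n. of_nat (Suc n choose Suc k) * f (Suc k) m)
        = (\<Sum>k\<le>n. of_nat (n choose k) * f (Suc k) m) + (\<Sum>k\<le>n. of_nat (n choose Suc k) * f (Suc k) m)"
      by (simp add: sum.distrib[symmetric] algebra_simps)
    also have "f 0 m + (\<dots>) = (\<Sum>k\<le>n. of_nat (n choose k) * f (Suc k) m)
        + (\<Sum>k\<le>Suc n. of_nat (n choose k) * f k m)"
      by (subst sum.atMost_Suc_shift[of "\<lambda>k. of_nat (n choose k) * f k m"]) simp
    also have "(\<Sum>k\<le>Suc n. of_nat (n choose k) * f k m) = (\<Sum>k\<le>n. of_nat (n choose k) * f k m)"
      by (simp add: binomial_eq_0)
    finally show ?thesis by (simp add: algebra_simps sum.distrib)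
  qed
  then show ?case
    using * by (simp add: funpow_Suc_right AB Suc.IH f_def del: funpow.simps)
qed simp

lemma shift_singleton_pow: "(shift {i} c r ^^ n) v = shift {i} (\<lambda>i. c i ^ n) (r * n) v"
proof (induction n)
  case (Suc n)
  then show ?case by (auto simp: shift_def fun_eq_iff algebra_simps)
qed (auto simp: shift_def)

text \<open>Variables are split off one at a time; the inner binomial coefficients are divisible by
  p, so only the two pure powers survive.\<close>

lemma frobenius_shift:
  fixes c :: "'i \<Rightarrow> 'k::field"
  assumes "finite I" "Factorial_Ring.prime CHAR('k)"
  shows "shift I c r ^^ CHAR('k) = shift I (\<lambda>i. c i ^ CHAR('k)) (r * CHAR('k))"
proof
  fix v :: "('i \<Rightarrow> nat) \<Rightarrow> 'k"
  let ?p = "CHAR('k)"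
  show "(shift I c r ^^ ?p) v = shift I (\<lambda>i. c i ^ ?p) (r * ?p) v"
    using assms(1)
  proof (induction I rule: finite_induct)
    case empty
    \<comment> \<open>The form in no variables is the zero operator; its p-th iterate is zero
      because p is positive, whereas the zeroth iterate would be the identity.\<close>
    obtain n where "?p = Suc n" using prime_gt_0_nat[OF assms(2)] gr0_implies_Suc by blast
    then show ?case by (auto simp: shift_def)
  next
    case (insert i I)
    have "(shift (insert i I) c r ^^ ?p) v m = shift (insert i I) (\<lambda>i. c i ^ ?p) (r * ?p) v m" for m
    proof -
      let ?f = "\<lambda>k. of_nat (?p choose k) * (shift {i} c r ^^ k) ((shift I c r ^^ (?p - k)) v) m"
      have 0: "?f k = 0" if "k \<in> {..?p} - {0, ?p}" for k
      proof -
        have "?p dvd (?p choose k)"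
          using that assms(2) by (intro dvd_choose_prime) auto
        then have "of_nat (?p choose k) = (0 :: 'k)"
          by (simp add: of_nat_eq_0_iff_char_dvd)
        then show ?thesis by simp
      qed
      have "(shift (insert i I) c r ^^ ?p) v m = (\<Sum>k\<le>?p. ?f k)"
        using insert.hyps by (simp add: binomial_shift_insert)
      also have "\<dots> = (\<Sum>k\<in>{0, ?p}. ?f k)"
        using 0 by (intro sum.mono_neutral_right) auto
      also have "\<dots> = (shift I c r ^^ ?p) v m + (shift {i} c r ^^ ?p) v m"
        using prime_gt_0_nat[OF assms(2)] by auto
      also have "\<dots> = shift (insert i I) (\<lambda>i. c i ^ ?p) (r * ?p) v m"
        using insert.hyps unfolding insert.IH shift_singleton_pow by (simp add: shift_def)
      finally show ?thesis .
    qed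
    then show ?case by blast
  qed
qed

lemma frobenius_shift_power:
  fixes c :: "'i \<Rightarrow> 'k::field"
  assumes "finite I" "Factorial_Ring.prime CHAR('k)"
  shows "shift I c 1 ^^ (CHAR('k) ^ k) = shift I (\<lambda>i. c i ^ (CHAR('k) ^ k)) (CHAR('k) ^ k)"
proof (induction k)
  case (Suc k)
  have "shift I c 1 ^^ (CHAR('k) ^ Suc k) = (shift I c 1 ^^ (CHAR('k) ^ k)) ^^ CHAR('k)"
    by (simp add: funpow_mult mult.commute)
  also have "\<dots> = shift I (\<lambda>i. (c i ^ (CHAR('k) ^ k)) ^ CHAR('k)) (CHAR('k) ^ k * CHAR('k))"
    unfolding Suc by (rule frobenius_shift[OF assms])
  finally show ?case
    by (simp add: power_mult[symmetric] mult.commute)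
qed simp

text \<open>
  The restriction of \<open>h\<close> to the exponents congruent to \<open>\<rho>\<close> modulo \<open>p\<close> lives on a box with sides
  \<open>\<lceil>(a\<^sub>i - \<rho>\<^sub>i) / p\<rceil>\<close>. As \<open>\<Sum>\<^sub>i \<rho>\<^sub>i \<equiv> -1\<close> modulo \<open>p\<close> and there are three variables, \<open>\<Sum>\<^sub>i \<rho>\<^sub>i\<close> is
  \<open>p - 1\<close> or \<open>2p - 1\<close>; in the second case one side has to be enlarged by one.
\<close>

lemma frobenius_descent:
  fixes c :: "'i \<Rightarrow> 'k::field"
  assumes fin: "finite I" and I: "card I = 3" and p: "Factorial_Ring.prime p" "p = CHAR('k)"
    and T: "\<And>a. 2 * M \<le> sum a I \<Longrightarrow> lef_inj I a (\<lambda>i. c i ^ p) (M - 2)" and M: "2 \<le> M"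
    and N: "2 * (p * M) \<le> sum a I"
    and h: "\<And>m. m \<in> box I a (p * M - 1) \<Longrightarrow> shift I (\<lambda>i. c i ^ p) p h m = 0"
    and m: "m \<in> box I a (p * M - 1 - p)"
  shows "h m = 0"
proof -
  have p0: "2 \<le> p" using prime_ge_2_nat[OF p(1)] .
  define \<rho> where "\<rho> i = m i mod p" for i
  define b where "b i = (a i + p - 1 - \<rho> i) div p" for i
  define w where "w m' = h (\<lambda>i. p * m' i + \<rho> i)" for m'
  have \<rho>: "\<rho> i < p" for i using p0 by (simp add: \<rho>_def)
  have b: "x < b i \<longleftrightarrow> p * x + \<rho> i < a i" for x i
  proof -
    have "x < b i \<longleftrightarrow> Suc x * p \<le> a i + p - 1 - \<rho> i"
      unfolding b_def Suc_le_eq[symmetric] using p0 by (simp add: less_eq_div_iff_mult_less_eq)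
    also have "\<dots> \<longleftrightarrow> p * x + \<rho> i < a i"
      using \<rho>[of i] p0 by (auto simp: algebra_simps)
    finally show ?thesis .
  qed
  define d' where "d' = (\<Sum>i\<in>I. m i div p)"
  define R where "R = sum \<rho> I"
  have deg: "p * d' + R = p * M - 1 - p"
  proof -
    have "p * d' + R = (\<Sum>i\<in>I. p * (m i div p) + m i mod p)"
      unfolding d'_def R_def \<rho>_def by (simp only: sum.distrib sum_distrib_left)
    also have "\<dots> = sum m I" by simp
    finally show ?thesis using m unfolding box_def by simp
  qed
  have pM: "2 * p \<le> p * M" using M p0 by simp
  have deg': "p * Suc d' + R = p * M - 1"
    using deg pM p0 unfolding mult_Suc_right by linarith
  have \<rho>0: "\<rho> i = 0" if "i \<notin> I" for i
    using m that unfolding box_def \<rho>_def by simp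
  have box: "(\<lambda>i. p * m' i + \<rho> i) \<in> box I a (p * e + R)" if "m' \<in> box I b e" for m' e
    using that b \<rho>0 unfolding box_def R_def by (auto simp: sum.distrib sum_distrib_left)
  have "lef_inj I b (\<lambda>i. c i ^ p) d'"
  proof -
    \<comment> \<open>\<open>b i\<close> is the first index outside its own range. Summing these
      bounds estimates the total side length of the residue box from below.\<close>
    have "p * b i + \<rho> i \<ge> a i" for i
      using b[of "b i" i] by simp
    then have "(\<Sum>i\<in>I. p * b i + \<rho> i) \<ge> sum a I" by (intro sum_mono) auto
    then have sb: "p * sum b I + R \<ge> 2 * (p * M)"
      using N unfolding R_def by (simp add: sum.distrib sum_distrib_left)
    have "R \<le> (\<Sum>i\<in>I. p - 1)"
      unfolding R_def using \<rho> p0 by (intro sum_mono) (metis Suc_pred' less_Suc_eq_le gr0I not_numeral_le_zero)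
    then have R3: "R \<le> 3 * p - 3" using I by simp
    have "p dvd R + 1"
    proof -
      have "p * Suc d' + (R + 1) = p * M" using deg' pM p0 by linarith
      then show ?thesis by (metis dvd_add_right_iff dvd_triv_left)
    qed
    then obtain r where r: "R + 1 = p * r" by blast
    have "r < 3"
    proof (rule ccontr)
      assume "\<not> r < 3"
      then have "p * 3 \<le> p * r" by simp
      then show False using R3 r p0 by linarith
    qed
    moreover have "r \<noteq> 0" using r by (intro notI) simp
    ultimately have "r = 1 \<or> r = 2" by linarith
    have cancel: "x = y" if "p * x = p * y" for x y
      using that p0 by simp
    have cancel_less: "x < y" if "p * x < p * y" for x y
      using that by simp
    from \<open>r = 1 \<or> r = 2\<close> show ?thesis
    proof
      assume 1: "r = 1"
      have "p * (d' + 2) = p * M"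
        using deg' r 1 pM p0 by (simp only: distrib_left mult_Suc_right; linarith)
      from cancel[OF this] have "d' = M - 2" by arith
      \<comment> \<open>Here R = p - 1 is less than one multiple of p, so the estimate can be
        rounded after dividing by p.\<close>
      moreover have "p * (2 * M) < p * (sum b I + 1)"
        using sb r 1 p0 by (simp only: distrib_left mult.left_commute[of p 2]; linarith)
      from cancel_less[OF this] have "2 * M \<le> sum b I" by simp
      ultimately show ?thesis using T[of b] by (simp only:)
    next
      assume 2: "r = 2"
      have "p * (d' + 3) = p * M"
        using deg' r 2 pM p0 by (simp only: distrib_left mult_Suc_right; linarith)
      \<comment> \<open>Here R = 2p - 1: the degree is one short of M - 2 and the total side length
        at most one short of 2M. Multiplication by one variable raises both.\<close>
      from cancel[OF this] have d': "Suc d' = M - 2" by arith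
      have "p * (2 * M) < p * (sum b I + 2)"
        using sb r 2 p0 by (simp only: distrib_left mult.left_commute[of p 2]; linarith)
      from cancel_less[OF this] have sb': "2 * M \<le> sum b I + 1" by simp
      have "I \<noteq> {}" using I by auto
      then obtain i where i: "i \<in> I" by blast
      have "sum (b(i := Suc (b i))) I = sum b I + 1"
        using sum_fun_upd[OF fin i, of b "Suc (b i)"] by simp
      then have "lef_inj I (b(i := Suc (b i))) (\<lambda>i. c i ^ p) (Suc d')"
        unfolding d' using sb' by (intro T) simp
      then show ?thesis by (rule lef_inj_embed[OF fin i])
    qed
  qed
  then have "w (\<lambda>i. m i div p) = 0"
  proof (rule lef_injD)
    show "(\<lambda>i. m i div p) \<in> box I b d'"
      using m unfolding box_def d'_def by (auto simp: b \<rho>_def)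
    fix m' assume m': "m' \<in> box I b (Suc d')"
    \<comment> \<open>T_i^p preserves residues and acts on the quotient exponents as T_i
      does.\<close>
    have "shift I (\<lambda>i. c i ^ p) 1 w m' = shift I (\<lambda>i. c i ^ p) p h (\<lambda>i. p * m' i + \<rho> i)"
      unfolding shift_def
    proof (intro sum.cong refl)
      fix i assume "i \<in> I"
      have "1 \<le> m' i \<longleftrightarrow> p \<le> p * m' i + \<rho> i"
        using \<rho>[of i] by (cases "m' i") auto
      moreover have "(\<lambda>j. p * (m'(i := m' i - 1)) j + \<rho> j)
          = (\<lambda>j. p * m' j + \<rho> j)(i := p * m' i + \<rho> i - p)" if "1 \<le> m' i"
        using that by (cases "m' i") (auto simp: fun_eq_iff)
      ultimately show "(if 1 \<le> m' i then c i ^ p * w (m'(i := m' i - 1)) else 0) =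
          (if p \<le> p * m' i + \<rho> i
           then c i ^ p * h ((\<lambda>i. p * m' i + \<rho> i)(i := p * m' i + \<rho> i - p)) else 0)"
        unfolding w_def by auto
    qed
    also have "\<dots> = 0"
      using box[OF m'] unfolding deg' by (rule h)
    finally show "shift I (\<lambda>i. c i ^ p) 1 w m' = 0" .
  qed
  then show ?thesis by (simp add: w_def \<rho>_def)
qed

section \<open>Three variables: induction on the power of p\<close>

lemma lef_inj_three_step:
  fixes c :: "'i \<Rightarrow> 'k::field"
  assumes fin: "finite I" and I: "card I = 3" and p: "Factorial_Ring.prime p" "p = CHAR('k)"
    and c: "\<And>i. i \<in> I \<Longrightarrow> c i \<noteq> 0"
    and T: "\<And>a. 2 * M \<le> sum a I \<Longrightarrow> lef_inj I a (\<lambda>i. c i ^ p) (M - 2)" and M: "2 \<le> M"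
    and N: "2 * (p * M) \<le> sum a I"
  shows "lef_inj I a c (p * M - 2)"
proof -
  have p0: "2 \<le> p" using prime_ge_2_nat[OF p(1)] .
  have pM: "2 * p \<le> p * M" using M p0 by simp
  \<comment> \<open>With three variables s = \<open>sum a I\<close> - 3, so the least admissible sum
    2pM is the middle case s = 2d + 1 for d = pM - 2. Larger sums reduce to it by truncating
    exponents.\<close>
  show ?thesis using N
  proof (induction "sum a I" arbitrary: a rule: less_induct)
    case less
    show ?case
    proof (cases "\<exists>i\<in>I. a i = 0")
      case True
      then show ?thesis unfolding lef_inj_def box_def by auto
    next
      case False
      then have a1: "\<And>i. i \<in> I \<Longrightarrow> 1 \<le> a i" by force
      have s: "(\<Sum>i\<in>I. a i - 1) + 3 = sum a I"
        using sum_pred[of I a] a1 I by simp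
      show ?thesis
      proof (cases "sum a I = 2 * (p * M)")
        case True
        define d where "d = p * M - 2"
        have d: "(\<Sum>i\<in>I. a i - 1) = 2 * d + 1" "Suc d = p * M - 1" "p - 1 \<le> d"
          using s True pM p0 unfolding d_def by linarith+
        show ?thesis
        proof (rule lef_injI, fold d_def)
          fix v m assume v: "\<And>m. m \<in> box I a (Suc d) \<Longrightarrow> shift I c 1 v m = 0" and m: "m \<in> box I a d"
          let ?L = "lower I a c"
          define h where "h = (?L ^^ (p - 1)) v"
          \<comment> \<open>Climbing back from h = D^{p-1} v: each multiplication by the form undoes
            one D up to the factor -(j+1)^2, where j + 1 runs from p - 1 down to 1 and is therefore
            a unit.\<close>
          have up: "\<exists>u. u \<noteq> 0 \<and> (\<forall>m\<in>box I a (d - (p - 1) + r).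
              (shift I c 1 ^^ r) h m = u * (?L ^^ (p - 1 - r)) v m)" if "r \<le> p - 1" for r
            using that
          proof (induction r)
            case 0
            show ?case unfolding h_def by (intro exI[of _ 1]) simp
          next
            case (Suc r)
            then obtain u where u: "u \<noteq> 0" "\<And>m. m \<in> box I a (d - (p - 1) + r) \<Longrightarrow>
                (shift I c 1 ^^ r) h m = u * (?L ^^ (p - 1 - r)) v m" by auto
            define j where "j = p - 1 - Suc r"
            have j: "Suc j = p - 1 - r" using Suc.prems unfolding j_def by simp
            have "\<not> p dvd Suc j" using j p0 by (intro nat_dvd_not_less) auto
            then have nz: "of_nat (Suc j) \<noteq> (0 :: 'k)"
              unfolding p(2) of_nat_eq_0_iff_char_dvd by simp
            have "(shift I c 1 ^^ Suc r) h m = (u * - (of_nat (Suc j))\<^sup>2) * (?L ^^ j) v m"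
              if m: "m \<in> box I a (d - (p - 1) + Suc r)" for m
            proof -
              have dj: "d - (p - 1) + Suc r = d - j" using d(3) j by simp
              have mj: "m \<in> box I a (d - j)" using m unfolding dj .
              have "(shift I c 1 ^^ Suc r) h m = shift I c 1 (\<lambda>m. u * (?L ^^ Suc j) v m) m"
                using m u(2) j by (auto intro!: shift_cong[OF fin, of _ _ "d - (p - 1) + r"])
              also have "\<dots> = u * shift I c 1 ((?L ^^ Suc j) v) m"
                by (rule shift_smult)
              also have "shift I c 1 ((?L ^^ Suc j) v) m = - (of_nat (Suc j))\<^sup>2 * (?L ^^ j) v m"
                using d j mj by (intro raise_lower_power[OF fin c d(1) v]) auto
              finally show ?thesis by simp
            qed
            moreover have "u * - (of_nat (Suc j))\<^sup>2 \<noteq> 0" using u(1) nz by simp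
            ultimately show ?case unfolding j_def by blast
          qed
          from up[of "p - 1"] obtain u where u: "u \<noteq> 0"
            "\<And>m. m \<in> box I a d \<Longrightarrow> (shift I c 1 ^^ (p - 1)) h m = u * v m"
            using d(3) by auto
          \<comment> \<open>At the top of the climb the form to the power p - 1 sends h to u v. One
            more multiplication gives zero, and by Frobenius the p-th power is the form in the T_i^p
            to which the descent applies.\<close>
          have "h m = 0" if "m \<in> box I a (d - (p - 1))" for m
          proof (rule frobenius_descent[OF fin I p T M less.prems])
            show "m \<in> box I a (p * M - 1 - p)" using that d p0 by (simp add: Suc_diff_Suc)
            fix m assume m: "m \<in> box I a (p * M - 1)"
            have "shift I (\<lambda>i. c i ^ p) p h m = (shift I c 1 ^^ Suc (p - 1)) h m"
              using frobenius_shift[OF fin, of c 1] p prime_gt_0_nat[OF p(1)] by (simp del: funpow.simps)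
            also have "\<dots> = shift I c 1 (\<lambda>m. u * v m) m"
              using u(2) m d(2) by (auto intro!: shift_cong[OF fin, of _ _ d])
            also have "\<dots> = 0" using v m d(2) by (simp add: shift_smult)
            finally show "shift I (\<lambda>i. c i ^ p) p h m = 0" .
          qed
          then have "(shift I c 1 ^^ r) h m = 0" if "m \<in> box I a (d - (p - 1) + r)" for r m
            using that
          proof (induction r arbitrary: m)
            case (Suc r)
            have "shift I c 1 ((shift I c 1 ^^ r) h) m = shift I c 1 (\<lambda>_. 0) m"
              using Suc.prems by (intro shift_cong[OF fin, of _ a "d - (p - 1) + r"] Suc.IH) auto
            then show ?case by simp
          qed simp
          from this[of m "p - 1"] show "v m = 0" using u m d(3) by simp
        qed
      next
        case False
        show ?thesis
        proof (rule lef_inj_quotient[OF fin a1])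
          show "p * M - 2 < (\<Sum>i\<in>I. a i - 1)" using s less.prems pM p0 by linarith
          fix i assume i: "i \<in> I" "2 \<le> a i"
          have "sum (a(i := a i - 1)) I + 1 = sum a I"
            using sum_fun_upd[OF fin i(1), of a "a i - 1"] i(2) by simp
          then show "lef_inj I (a(i := a i - 1)) c (p * M - 2)"
            using False less.prems by (intro less.hyps) auto
        qed
      qed
    qed
  qed
qed

text \<open>For positive exponents the bound on \<open>sum a I\<close> says 2d + 1 \<le> s for d =
  p^k m - 2. For k = 0 the characteristic is large enough since d + 1 = m - 1 < p; each further
  factor p is one descent, which replaces c_i by c_i^p.\<close>

lemma lef_inj_three:
  fixes c :: "'i \<Rightarrow> 'k::field"
  assumes fin: "finite I" and I: "card I = 3" and p: "Factorial_Ring.prime p" "p = CHAR('k)"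
    and c: "\<And>i. i \<in> I \<Longrightarrow> c i \<noteq> 0" and m: "2 \<le> m" "m \<le> p"
    and N: "2 * (p ^ k * m) \<le> sum a I"
  shows "lef_inj I a c (p ^ k * m - 2)"
  using c N
proof (induction k arbitrary: a c)
  case 0
  show ?case
  proof (cases "\<exists>i\<in>I. a i = 0")
    case True
    then show ?thesis unfolding lef_inj_def box_def by auto
  next
    case False
    then have a1: "\<And>i. i \<in> I \<Longrightarrow> 1 \<le> a i" by force
    have s: "(\<Sum>i\<in>I. a i - 1) + 3 = sum a I"
      using sum_pred[of I a] a1 I by simp
    have "of_nat j \<noteq> (0 :: 'k)" if "1 \<le> j" "j \<le> Suc (m - 2)" for j
    proof -
      have "\<not> p dvd j" using that m by (intro nat_dvd_not_less) auto
      then show ?thesis unfolding p(2) of_nat_eq_0_iff_char_dvd .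
    qed
    then show ?thesis
      using s 0 m a1 by (intro lef_inj_char_large[OF fin]) auto
  qed
next
  case (Suc k)
  have pk: "p ^ k \<ge> 1" using prime_gt_0_nat[OF p(1)] by simp
  have "lef_inj I a c (p * (p ^ k * m) - 2)"
  proof (rule lef_inj_three_step[OF fin I p Suc.prems(1)])
    show "2 \<le> p ^ k * m" using mult_le_mono[OF pk m(1)] by simp
    show "lef_inj I a (\<lambda>i. c i ^ p) (p ^ k * m - 2)" if "2 * (p ^ k * m) \<le> sum a I" for a
      using that Suc.prems(1) by (intro Suc.IH) auto
    show "2 * (p * (p ^ k * m)) \<le> sum a I" using Suc.prems(2) by (simp add: mult.assoc)
  qed auto
  then show ?case by (simp add: mult.assoc)
qed

section \<open>Four variables in characteristic two and duality\<close>

text \<open>T_i acts as leading term: the coefficient of the product at T_i m involves c_i times the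
  value at m and otherwise only values at monomials with a higher power of T_i. Descending induction
  on that power applies, and a_i \<ge> d + 2 keeps T_i m in the box.\<close>

lemma lef_inj_large_exponent:
  fixes c :: "'i \<Rightarrow> 'k::field"
  assumes fin: "finite I" and i: "i \<in> I" "c i \<noteq> 0" and a: "d + 2 \<le> a i"
  shows "lef_inj I a c d"
proof (rule lef_injI)
  fix v m assume v: "\<And>m. m \<in> box I a (Suc d) \<Longrightarrow> shift I c 1 v m = 0" and "m \<in> box I a d"
  have le: "m i \<le> d" if "m \<in> box I a d" for m
    using that member_le_sum[of i I m] i fin unfolding box_def by auto
  show "v m = 0" using \<open>m \<in> box I a d\<close>
  proof (induction "d - m i" arbitrary: m rule: less_induct)
    case less
    let ?m = "m(i := m i + 1)"
    have m': "?m \<in> box I a (Suc d)"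
      using box_up[OF fin i(1) less.prems, of 1] le[OF less.prems] a by simp
    have "v (?m(j := ?m j - 1)) = 0" if j: "j \<in> I - {i}" "1 \<le> ?m j" for j
    proof (rule less.hyps)
      show b: "?m(j := ?m j - 1) \<in> box I a d"
        using box_down[OF fin, of j ?m a d 1] m' j by simp
      show "d - (?m(j := ?m j - 1)) i < d - m i"
        using le[OF b] j by auto
    qed
    then have "shift I c 1 v ?m = c i * v m"
      unfolding shift_def sum.remove[OF fin i(1)] by (simp add: sum.neutral)
    then show ?case using v[OF m'] i(2) by simp
  qed
qed

text \<open>Setting T_i = 0 turns a kernel element into one for the remaining variables, which
  controls the coefficients of all monomials without T_i.\<close>

lemma lef_inj_delete:
  assumes fin: "finite I" and i: "i \<in> I" "m i = 0" and inj: "lef_inj (I - {i}) a c d"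
    and v: "\<And>m. m \<in> box I a (Suc d) \<Longrightarrow> shift I c 1 v m = 0" and m: "m \<in> box I a d"
  shows "v m = 0"
proof (rule lef_injD[OF inj])
  have box: "m \<in> box (I - {i}) a e \<longleftrightarrow> m \<in> box I a e \<and> m i = 0" if "0 < a i" for m e
    using that i(1) sum.remove[OF fin i(1), of m] unfolding box_def by auto
  have a: "0 < a i" using m i unfolding box_def by auto
  show "m \<in> box (I - {i}) a d" using m i box[OF a] by simp
  fix m' assume m': "m' \<in> box (I - {i}) a (Suc d)"
  have "shift (I - {i}) c 1 v m' = shift I c 1 v m'"
    using m' box[OF a] unfolding shift_def sum.remove[OF fin i(1)] by simp
  then show "shift (I - {i}) c 1 v m' = 0"
    using v m' box[OF a] by simp
qed

lemma lef_inj_four: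
  fixes c :: "'i \<Rightarrow> 'k::field"
  assumes fin: "finite I" and I: "card I = 4" and p: "CHAR('k) = 2"
    and c: "\<And>i. i \<in> I \<Longrightarrow> c i \<noteq> 0" and N: "sum a I = 10"
  shows "lef_inj I a c 2"
proof (cases "\<exists>i\<in>I. 4 \<le> a i")
  case True
  then obtain i where "i \<in> I" "4 \<le> a i" by blast
  then show ?thesis using lef_inj_large_exponent[OF fin _ c] by simp
next
  case False
  then have a3: "a i \<le> 3" if "i \<in> I" for i using that by force
  show ?thesis
  proof (rule lef_injI)
    fix v m assume v: "\<And>m. m \<in> box I a (Suc 2) \<Longrightarrow> shift I c 1 v m = 0" and m: "m \<in> box I a 2"
    have del: "v m = 0" if "i \<in> I" "a i \<le> 2" "m i = 0" "m \<in> box I a 2" for i m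
    proof (rule lef_inj_delete[OF fin _ _ _ v])
      \<comment> \<open>The other three exponents sum to at least 8 = 2 * (2 * 2), the bound of the
        three-variable result in degree 2 * 2 - 2.\<close>
      have "sum a (I - {i}) \<ge> 8" using sum.remove[OF fin that(1), of a] N that(2) by simp
      then have "lef_inj (I - {i}) a c (2 ^ 1 * 2 - 2)"
        using fin I that(1) c by (intro lef_inj_three[OF _ _ two_is_prime_nat p[symmetric]]) auto
      then show "lef_inj (I - {i}) a c 2" by simp
    qed (use that in auto)
    define J where "J = {i \<in> I. a i \<le> 2}"
    show "v m = 0"
    proof (cases "\<exists>i\<in>J. m i = 0")
      case True
      then show ?thesis using del m unfolding J_def by auto
    next
      case False
      then have J: "a i = 2" "m i = 1" if "i \<in> J" for i
        using that m unfolding J_def box_def by (force+)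
      have finJ: "finite J" "J \<subseteq> I" using fin unfolding J_def by auto
      have "sum a I = sum a J + sum a (I - J)"
        using fin finJ by (metis add.commute sum.subset_diff)
      also have "sum a J = 2 * card J" using J by simp
      also have "sum a (I - J) = (\<Sum>i\<in>I - J. 3)"
        using a3 unfolding J_def by (intro sum.cong) force+
      also have "\<dots> = 3 * card (I - J)" by simp
      also have "card (I - J) = 4 - card J" using finJ I by (simp add: card_Diff_subset)
      \<comment> \<open>From 2 |J| + 3 (4 - |J|) = 10. As m has degree 2, it is the product of the
        two variables in \<open>J\<close>, the only monomial not yet covered.\<close>
      finally have "card J = 2" using N card_mono[OF fin finJ(2)] I by simp
      have "sum m I = sum m J + sum m (I - J)"
        using fin finJ by (metis add.commute sum.subset_diff)
      moreover have "sum m J = 2" using J \<open>card J = 2\<close> by simp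
      ultimately have m0: "m i = 0" if "i \<in> I - J" for i
        using that m fin unfolding box_def by simp
      have "I - J \<noteq> {}" using \<open>card J = 2\<close> I card_mono[OF finJ(1), of I] by auto
      then obtain x where x: "x \<in> I - J" by blast
      let ?m = "m(x := m x + 1)"
      have m': "?m \<in> box I a (Suc 2)"
        using box_up[OF fin _ m, of x 1] x m0 unfolding J_def by auto
      \<comment> \<open>Besides m, the neighbours of T_x m are obtained by dropping a variable of
        \<open>J\<close>, so their coefficients already vanish and the equation at T_x m isolates
        the one at m.\<close>
      have "v (?m(j := ?m j - 1)) = 0" if j: "j \<in> I - {x}" "1 \<le> ?m j" for j
      proof -
        have "j \<in> J" using j m0 by (cases "j \<in> J") auto
        then show ?thesis
          using j m' J[of j] box_down[OF fin, of j ?m a 2 1] by (intro del[of j]) auto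
      qed
      then have "shift I c 1 v ?m = c x * v m"
        using x unfolding shift_def by (simp add: sum.remove[OF fin, of x] sum.neutral)
      then show ?thesis using v[OF m'] c x by simp
    qed
  qed
qed

section \<open>Linear algebra, the Hilbert function, and duality\<close>

lemma finite_box:
  assumes "finite I"
  shows "finite (box I a d)"
proof -
  have "box I a d \<subseteq> {f. (\<forall>i. (i \<in> I \<longrightarrow> f i \<in> {..d}) \<and> (i \<notin> I \<longrightarrow> f i = 0))}"
    using member_le_sum[OF _ _ assms] unfolding box_def by fastforce
  then show ?thesis
    using finite_set_of_finite_funs[OF assms, of "{..d}" 0] finite_subset by blast
qed

text \<open>A proper subspace of k^A lies in a hyperplane. Induction on A: either evaluation at x
  vanishes on W, or W is spanned by some \<open>v1\<close> with value 1 at x together with the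
  elements vanishing at x.\<close>

lemma subspace_full_or_annihilated:
  fixes W :: "('x \<Rightarrow> 'k::field) set"
  assumes "finite A" "W \<noteq> {}" and "\<And>x y v w. v \<in> W \<Longrightarrow> w \<in> W \<Longrightarrow> (\<lambda>m. x * v m + y * w m) \<in> W"
  shows "(\<forall>f. \<exists>v\<in>W. \<forall>x\<in>A. v x = f x) \<or>
    (\<exists>\<phi>. (\<exists>x\<in>A. \<phi> x \<noteq> 0) \<and> (\<forall>v\<in>W. (\<Sum>x\<in>A. \<phi> x * v x) = 0))"
  using assms
proof (induction A arbitrary: W rule: finite_induct)
  case empty
  then show ?case by auto
next
  case (insert x A)
  note lin = insert.prems(2)
  show ?case
  proof (cases "\<forall>v\<in>W. v x = 0")
    case True
    have "(\<Sum>y\<in>insert x A. (if y = x then 1 else 0) * v y) = 0" if "v \<in> W" for v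
      using that True insert.hyps by (intro sum.neutral) auto
    then show ?thesis
      by (intro disjI2 exI[of _ "\<lambda>y. if y = x then 1 else 0"]) auto
  next
    case False
    then obtain v0 where v0: "v0 \<in> W" "v0 x \<noteq> 0" by blast
    \<comment> \<open>The zero summand puts the scalar multiple into the two-term shape of the
      closure hypothesis.\<close>
    define v1 where "v1 = (\<lambda>m. (1 / v0 x) * v0 m + 0 * v0 m)"
    have v1: "v1 \<in> W" "v1 x = 1" using lin[OF v0(1) v0(1), of "1 / v0 x" 0] v0(2) unfolding v1_def by auto
    define W0 where "W0 = {v \<in> W. v x = 0}"
    have "(\<lambda>m. v0 m + (- v0 x) * v1 m) \<in> W0"
      using lin[OF v0(1) v1(1), of 1 "- v0 x"] v1(2) unfolding W0_def by simp
    then have W0: "W0 \<noteq> {}" by blast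
    have "(\<forall>f. \<exists>v\<in>W0. \<forall>x\<in>A. v x = f x) \<or>
      (\<exists>\<phi>. (\<exists>x\<in>A. \<phi> x \<noteq> 0) \<and> (\<forall>v\<in>W0. (\<Sum>x\<in>A. \<phi> x * v x) = 0))"
    proof (rule insert.IH[OF W0])
      fix r r' v w assume "v \<in> W0" "w \<in> W0"
      then show "(\<lambda>m. r * v m + r' * w m) \<in> W0"
        using lin[of v w r r'] unfolding W0_def by simp
    qed
    then show ?thesis
    proof
      assume full: "\<forall>f. \<exists>v\<in>W0. \<forall>x\<in>A. v x = f x"
      have "\<exists>v\<in>W. \<forall>y\<in>insert x A. v y = f y" for f
      proof -
        from full[rule_format, of "\<lambda>y. f y - f x * v1 y"]
        obtain v where v: "v \<in> W0" "\<forall>y\<in>A. v y = f y - f x * v1 y" by blast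
        have "(\<lambda>m. 1 * v m + f x * v1 m) \<in> W"
          by (rule lin) (use v1(1) v(1) in \<open>auto simp: W0_def\<close>)
        then show ?thesis
          using v v1(2) unfolding W0_def by (intro bexI) auto
      qed
      then show ?thesis by blast
    next
      assume "\<exists>\<phi>. (\<exists>x\<in>A. \<phi> x \<noteq> 0) \<and> (\<forall>v\<in>W0. (\<Sum>x\<in>A. \<phi> x * v x) = 0)"
      then obtain \<phi> where \<phi>: "\<exists>x\<in>A. \<phi> x \<noteq> 0" "\<And>v. v \<in> W0 \<Longrightarrow> (\<Sum>x\<in>A. \<phi> x * v x) = 0"
        by blast
      \<comment> \<open>The value at x is chosen so that the extended functional kills
        \<open>v1\<close>.\<close>
      define \<psi> where "\<psi> = \<phi>(x := - (\<Sum>y\<in>A. \<phi> y * v1 y))"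
      have "(\<Sum>y\<in>insert x A. \<psi> y * v y) = 0" if "v \<in> W" for v
      proof -
        have "(\<lambda>m. 1 * v m + (- v x) * v1 m) \<in> W0"
          using lin[OF that v1(1), of 1 "- v x"] v1(2) unfolding W0_def by simp
        from \<phi>(2)[OF this] have "(\<Sum>y\<in>A. \<phi> y * v y) = v x * (\<Sum>y\<in>A. \<phi> y * v1 y)"
          by (simp add: algebra_simps sum_subtractf sum_distrib_left)
        moreover have "(\<Sum>y\<in>A. \<psi> y * v y) = (\<Sum>y\<in>A. \<phi> y * v y)"
          using insert.hyps unfolding \<psi>_def by (intro sum.cong) auto
        ultimately show ?thesis
          using insert.hyps by (simp add: \<psi>_def)
      qed
      moreover have "\<exists>y\<in>insert x A. \<psi> y \<noteq> 0"
        using \<phi>(1) insert.hyps unfolding \<psi>_def by auto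
      ultimately show ?thesis by blast
    qed
  qed
qed

text \<open>Gaussian elimination: a pivot in equation y removes one unknown and one
  equation.\<close>

lemma more_unknowns_than_equations:
  fixes M :: "'x \<Rightarrow> 'y \<Rightarrow> 'k::field"
  assumes "finite Y" "finite A" "card Y < card A"
  shows "\<exists>v. (\<exists>x\<in>A. v x \<noteq> 0) \<and> (\<forall>y\<in>Y. (\<Sum>x\<in>A. v x * M x y) = 0)"
  using assms
proof (induction Y arbitrary: A M rule: finite_induct)
  case empty
  then have "A \<noteq> {}" by auto
  then show ?case by (intro exI[of _ "\<lambda>_. 1"]) auto
next
  case (insert y Y)
  show ?case
  proof (cases "\<forall>x\<in>A. M x y = 0")
    case True
    obtain v where "\<exists>x\<in>A. v x \<noteq> 0" "\<forall>y\<in>Y. (\<Sum>x\<in>A. v x * M x y) = 0"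
      using insert.IH[of A M] insert.prems insert.hyps by auto
    then show ?thesis using True by (intro exI[of _ v]) (auto intro!: sum.neutral)
  next
    case False
    then obtain x0 where x0: "x0 \<in> A" "M x0 y \<noteq> 0" by blast
    let ?A = "A - {x0}"
    have "card Y < card ?A" using insert.prems insert.hyps x0(1) by simp
    from insert.IH[OF finite_Diff[OF insert.prems(1)] this,
        of "\<lambda>x z. M x z - M x y / M x0 y * M x0 z"]
    obtain v where v: "\<exists>x\<in>?A. v x \<noteq> 0"
      "\<And>z. z \<in> Y \<Longrightarrow> (\<Sum>x\<in>?A. v x * (M x z - M x y / M x0 y * M x0 z)) = 0"
      by blast
    \<comment> \<open>Back substitution solves equation y for the pivot unknown.\<close>
    define w where "w = v(x0 := - (\<Sum>x\<in>?A. v x * M x y) / M x0 y)"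
    have w: "(\<Sum>x\<in>A. w x * M x z) = w x0 * M x0 z + (\<Sum>x\<in>?A. v x * M x z)" for z
      using insert.prems(1) x0(1) unfolding w_def by (auto simp: sum.remove[of A x0] intro!: sum.cong)
    have "(\<Sum>x\<in>A. w x * M x z) = 0" if "z \<in> insert y Y" for z
    proof (cases "z = y")
      case True
      then show ?thesis unfolding w using x0(2) by (simp add: w_def)
    next
      case False
      then have "z \<in> Y" using that by simp
      from v(2)[OF this] have "(\<Sum>x\<in>?A. v x * M x z) = (\<Sum>x\<in>?A. v x * M x y) / M x0 y * M x0 z"
        by (simp add: algebra_simps sum_subtractf sum_distrib_left sum_divide_distrib)
      then show ?thesis unfolding w by (simp add: w_def)
    qed
    moreover have "\<exists>x\<in>A. w x \<noteq> 0" using v(1) unfolding w_def by auto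
    ultimately show ?thesis by blast
  qed
qed

text \<open>The cardinalities do not depend on the field, so injectivity over one convenient field
  bounds the Hilbert function for all of them.\<close>

lemma lef_inj_imp_card_le:
  fixes c :: "'i \<Rightarrow> 'k::field"
  assumes fin: "finite I" and inj: "lef_inj I a c d"
  shows "card (box I a d) \<le> card (box I a (Suc d))"
proof (rule ccontr)
  assume "\<not> ?thesis"
  then have "card (box I a (Suc d)) < card (box I a d)" by simp
  from more_unknowns_than_equations[OF finite_box[OF fin] finite_box[OF fin] this,
      of "\<lambda>x. shift I c 1 (\<lambda>m. if m = x then 1 else 0)"]
  obtain v where v: "\<exists>x\<in>box I a d. v x \<noteq> 0"
    "\<And>y. y \<in> box I a (Suc d) \<Longrightarrow>
      (\<Sum>x\<in>box I a d. v x * shift I c 1 (\<lambda>m. if m = x then 1 else 0) y) = 0"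
    by blast
  have "shift I c 1 v y = 0" if "y \<in> box I a (Suc d)" for y
  proof -
    have "shift I c 1 v y = shift I c 1 (\<lambda>m. \<Sum>x\<in>box I a d. v x * (if m = x then 1 else 0)) y"
      using that finite_box[OF fin] by (intro shift_cong[OF fin, of _ _ d]) (auto simp: if_distrib[of "(*) _"] cong: if_cong)
    then show ?thesis using v(2)[OF that] by (simp add: shift_sum)
  qed
  then show False using v(1) inj unfolding lef_inj_def by blast
qed

text \<open>Unimodality of the Hilbert function, read off from injectivity in characteristic zero.\<close>

lemma card_box_increasing:
  assumes "finite I" "\<And>i. i \<in> I \<Longrightarrow> 1 \<le> a i" "2 * d + 1 \<le> (\<Sum>i\<in>I. a i - 1)"
  shows "card (box I a d) \<le> card (box I a (Suc d))"
  using assms lef_inj_char_large[of I "\<lambda>_. 1 :: rat" d a]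
  by (intro lef_inj_imp_card_le[of I a "\<lambda>_. 1 :: rat"]) auto

text \<open>The exponent of the complementary monomial in the socle pairing of degrees d and s - d;
  the value 0 outside I keeps it in a box.\<close>

definition reflect :: "'i set \<Rightarrow> ('i \<Rightarrow> nat) \<Rightarrow> ('i \<Rightarrow> nat) \<Rightarrow> 'i \<Rightarrow> nat" where
  "reflect I a m i = (if i \<in> I then a i - 1 - m i else 0)"

lemma reflect_box:
  assumes "m \<in> box I a d" "d + e = (\<Sum>i\<in>I. a i - 1)"
  shows "reflect I a m \<in> box I a e"
proof -
  have "sum (reflect I a m) I + sum m I = (\<Sum>i\<in>I. a i - 1)"
    unfolding sum.distrib[symmetric] reflect_def
    using assms(1) by (intro sum.cong) (auto simp: box_def)
  then show ?thesis
    using assms unfolding box_def reflect_def by force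
qed

lemma reflect_reflect:
  assumes "m \<in> box I a d"
  shows "reflect I a (reflect I a m) = m"
proof
  fix i
  show "reflect I a (reflect I a m) i = m i"
    using assms unfolding box_def reflect_def by (cases "i \<in> I") force+
qed

lemma card_box_reflect:
  assumes "d + e = (\<Sum>i\<in>I. a i - 1)"
  shows "card (box I a d) = card (box I a e)"
proof (rule bij_betw_same_card)
  show "bij_betw (reflect I a) (box I a d) (box I a e)"
    using reflect_box[OF _ assms] reflect_box[of _ I a e d] reflect_reflect assms
    by (intro bij_betw_byWitness[where f' = "reflect I a"]) (auto simp: add.commute)
qed

text \<open>Reflection carries this to the increasing half; from the socle degree on, the next box
  is empty.\<close>

lemma card_box_decreasing:
  assumes "finite I" "\<And>i. i \<in> I \<Longrightarrow> 1 \<le> a i" "(\<Sum>i\<in>I. a i - 1) \<le> 2 * d + 1"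
  shows "card (box I a (Suc d)) \<le> card (box I a d)"
proof (cases "d < (\<Sum>i\<in>I. a i - 1)")
  case True
  define e where "e = (\<Sum>i\<in>I. a i - 1) - Suc d"
  have "card (box I a e) \<le> card (box I a (Suc e))"
    using assms True unfolding e_def by (intro card_box_increasing) auto
  then show ?thesis
    using card_box_reflect[of "Suc d" e a I] card_box_reflect[of d "Suc e" a I] True
    unfolding e_def by simp
next
  case False
  have "sum m I \<le> (\<Sum>i\<in>I. a i - 1)" if "\<forall>i\<in>I. m i < a i" for m
    using that by (intro sum_mono) force
  then have "box I a (Suc d) = {}" using False unfolding box_def by fastforce
  then show ?thesis by simp
qed

text \<open>If the image were proper, a nonzero functional \<phi> would annihilate it. Since
  reflection makes multiplication self-transposed, \<phi> composed with \<open>reflect\<close> would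
  be a nonzero kernel element in degree e.\<close>

lemma lef_inj_imp_dual_surj:
  fixes c :: "'i \<Rightarrow> 'k::field"
  assumes fin: "finite I" and s: "d + e + 1 = (\<Sum>i\<in>I. a i - 1)" and inj: "lef_inj I a c e"
  shows "\<exists>v. \<forall>m\<in>box I a (Suc d). shift I c 1 v m = f m"
proof (rule ccontr)
  assume not: "\<not> ?thesis"
  let ?B = "box I a (Suc d)" and ?\<delta> = "\<lambda>k m. if m = k then 1 else 0 :: 'k"
  have "(\<forall>f. \<exists>v\<in>range (shift I c 1). \<forall>x\<in>?B. v x = f x) \<or>
    (\<exists>\<phi>. (\<exists>x\<in>?B. \<phi> x \<noteq> 0) \<and> (\<forall>v\<in>range (shift I c 1). (\<Sum>x\<in>?B. \<phi> x * v x) = 0))"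
  proof (rule subspace_full_or_annihilated[OF finite_box[OF fin]])
    fix x y :: 'k and v w assume "v \<in> range (shift I c 1)" "w \<in> range (shift I c 1)"
    then obtain v' w' where "v = shift I c 1 v'" "w = shift I c 1 w'" by auto
    then have "(\<lambda>m. x * v m + y * w m) = shift I c 1 (\<lambda>m. x * v' m + y * w' m)"
      by (simp add: shift_lincomb fun_eq_iff)
    then show "(\<lambda>m. x * v m + y * w m) \<in> range (shift I c 1)" by blast
  qed auto
  with not obtain \<phi> where \<phi>: "\<exists>x\<in>?B. \<phi> x \<noteq> 0" "\<And>v. (\<Sum>x\<in>?B. \<phi> x * shift I c 1 v x) = 0"
    by fast
  have *: "\<phi> (reflect I a m) = 0" if m: "m \<in> box I a e" for m
  proof (rule lef_injD[OF inj, where v = "\<lambda>m. \<phi> (reflect I a m)", OF _ m])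
    fix m assume m: "m \<in> box I a (Suc e)"
    define k where "k = reflect I a m"
    have k: "k \<in> box I a d" unfolding k_def using reflect_box[OF m] s by simp
    \<comment> \<open>\<phi> is tested on the form times the single monomial k.\<close>
    have "0 = (\<Sum>x\<in>?B. \<phi> x * shift I c 1 (?\<delta> k) x)" using \<phi>(2) by simp
    also have "\<dots> = (\<Sum>i\<in>I. \<Sum>x\<in>?B. \<phi> x * (if 1 \<le> x i then c i * ?\<delta> k (x(i := x i - 1)) else 0))"
      unfolding shift_def sum_distrib_left by (rule sum.swap)
    also have "\<dots> = (\<Sum>i\<in>I. if 1 \<le> m i then c i * \<phi> (reflect I a (m(i := m i - 1))) else 0)"
    proof (intro sum.cong refl)
      fix i assume i: "i \<in> I"
      let ?k = "k(i := k i + 1)"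
      have "\<phi> x * (if 1 \<le> x i then c i * ?\<delta> k (x(i := x i - 1)) else 0)
          = (if x = ?k then c i * \<phi> ?k else 0)" for x
      proof -
        have "1 \<le> x i \<and> x(i := x i - 1) = k \<longleftrightarrow> x = ?k" by (auto simp: fun_upd_idem_iff)
        then show ?thesis by auto
      qed
      then have "(\<Sum>x\<in>?B. \<phi> x * (if 1 \<le> x i then c i * ?\<delta> k (x(i := x i - 1)) else 0))
          = (if ?k \<in> ?B then c i * \<phi> ?k else 0)"
        using finite_box[OF fin] by (simp add: sum.delta)
      \<comment> \<open>As k_i = a_i - 1 - m_i, raising k_i stays in the box exactly when m_i can be
        lowered.\<close>
      also have "?k \<in> ?B \<longleftrightarrow> 1 \<le> m i"
      proof
        assume "?k \<in> ?B"
        then show "1 \<le> m i" using i m unfolding k_def box_def reflect_def by force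
      next
        assume "1 \<le> m i"
        moreover have "m i < a i" using m i unfolding box_def by auto
        ultimately show "?k \<in> ?B"
          using box_up[OF fin i k, of 1] i unfolding k_def reflect_def by auto
      qed
      also have "(if 1 \<le> m i then c i * \<phi> ?k else 0)
          = (if 1 \<le> m i then c i * \<phi> (reflect I a (m(i := m i - 1))) else 0)"
      proof -
        have "m i < a i" using m i unfolding box_def by auto
        then have "1 \<le> m i \<Longrightarrow> ?k = reflect I a (m(i := m i - 1))"
          using i unfolding k_def reflect_def by (auto simp: fun_eq_iff)
        then show ?thesis by auto
      qed
      finally show "(\<Sum>x\<in>?B. \<phi> x * (if 1 \<le> x i then c i * ?\<delta> k (x(i := x i - 1)) else 0)) =
         (if 1 \<le> m i then c i * \<phi> (reflect I a (m(i := m i - 1))) else 0)" .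
    qed
    finally show "shift I c 1 (\<lambda>m. \<phi> (reflect I a m)) m = 0" unfolding shift_def by simp
  qed
  have "\<phi> x = 0" if "x \<in> ?B" for x
  proof -
    have "reflect I a x \<in> box I a e" using that s by (intro reflect_box) auto
    then show ?thesis using *[of "reflect I a x"] reflect_reflect[OF that] by simp
  qed
  then show False using \<phi>(1) by blast
qed

section \<open>Failure of injectivity\<close>

text \<open>The last nonzero element among v and its products with powers of the form lies in the
  kernel; its degree is less than d + r.\<close>

lemma not_lef_inj_if_killed:
  fixes c :: "'i \<Rightarrow> 'k::field"
  assumes "m \<in> box I a d" "v m \<noteq> 0"
    and "\<And>m. m \<in> box I a (d + r) \<Longrightarrow> (shift I c 1 ^^ r) v m = 0"
  shows "\<exists>e < d + r. \<not> lef_inj I a c e"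
  using assms
proof (induction r)
  case 0
  then show ?case by auto
next
  case (Suc r)
  show ?case
  proof (cases "\<exists>m\<in>box I a (d + r). (shift I c 1 ^^ r) v m \<noteq> 0")
    case True
    have "\<not> lef_inj I a c (d + r)"
      using True Suc.prems(3) unfolding lef_inj_def by auto
    then show ?thesis by auto
  next
    case False
    then show ?thesis using Suc.IH Suc.prems(1,2) less_SucI by fastforce
  qed
qed

lemma not_lef_inj_frobenius:
  fixes c :: "nat \<Rightarrow> 'k::field" and a :: "nat \<Rightarrow> nat"
  assumes n: "3 \<le> n" and p: "Factorial_Ring.prime CHAR('k)" and q: "q = CHAR('k) ^ k" and t: "1 \<le> t"
    and a: "\<And>i. i < n \<Longrightarrow> 1 \<le> a i" "a 0 \<le> q + e" "e < a 0" "a 1 = t * q" "a 2 = t * q"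
      "\<And>i. 3 \<le> i \<Longrightarrow> i < n \<Longrightarrow> a i \<le> q"
  shows "\<exists>d < e + q * t. \<not> lef_inj {..<n} a c d"
proof -
  have q0: "0 < q" using q prime_gt_0_nat[OF p] by simp
  define C where "C i = c i ^ q" for i
  \<comment> \<open>The choice \<alpha> = \<open>C 1\<close>, \<beta> = \<open>C 2\<close> gives the
    cofactor of C_1 y + C_2 z in (C_1 y)^t - (-C_2 z)^t. If both coefficients vanish, (1, 1) keeps g
    nonzero.\<close>
  obtain \<alpha> \<beta> where \<alpha>\<beta>: "C 1 * \<beta> = C 2 * \<alpha>" "\<alpha> \<noteq> 0 \<or> \<beta> \<noteq> 0"
  proof (cases "C 1 = 0 \<and> C 2 = 0")
    case True
    then show ?thesis by (intro that[of 1 1]) auto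
  next
    case False
    then show ?thesis by (intro that[of "C 2" "C 1"]) auto
  qed
  \<comment> \<open>The support of T_0^e g(T_1^q, T_2^q) with g homogeneous of degree t - 1; the
    degree condition is written without subtraction.\<close>
  define P where "P m \<longleftrightarrow> m 0 = e \<and> (\<forall>i\<ge>3. m i = 0) \<and> q dvd m 1 \<and> q dvd m 2 \<and> m 1 + m 2 + q = q * t"
    for m :: "nat \<Rightarrow> nat"
  define v where "v m = (if P m then \<alpha> ^ (m 1 div q) * (- \<beta>) ^ (m 2 div q) else 0)" for m
  let ?d = "e + q * (t - 1)"
  have qt: "q * (t - 1) + q = q * t" using t by (cases t) auto
  have three: "i = 0 \<or> i = 1 \<or> i = 2 \<or> 3 \<le> i" for i :: nat by auto
  have "\<exists>m\<in>box {..<n} a ?d. v m \<noteq> 0"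
  proof -
    \<comment> \<open>Candidates for a nonzero coefficient are the two pure powers, T_1^{q(t-1)} or
      T_2^{q(t-1)} times T_0^e; which one serves depends on whether \<alpha> vanishes.\<close>
    define m1 where "m1 x y = (\<lambda>_ :: nat. 0)(0 := e, 1 := x, 2 := y)" for x y :: nat
    have sum: "sum (m1 x y) {..<n} = e + x + y" for x y
    proof -
      have "sum (m1 x y) {..<n} = sum (m1 x y) {0, 1, 2}"
        using n by (intro sum.mono_neutral_right) (auto simp: m1_def)
      then show ?thesis by (simp add: m1_def)
    qed
    have "m1 x y \<in> box {..<n} a ?d" if "x + y = q * (t - 1)" for x y
    proof -
      have "x < t * q" "y < t * q" using that qt q0 by (simp_all add: mult.commute)
      then have "m1 x y i < a i" if "i < n" for i
        using three[of i] a(1)[OF that] a(3-5) by (auto simp: m1_def)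
      moreover have "m1 x y i = 0" if "i \<notin> {..<n}" for i
        using that n by (auto simp: m1_def)
      ultimately show ?thesis
        using that unfolding box_def by (auto simp: sum)
    qed
    from this[of "q * (t - 1)" 0] this[of 0 "q * (t - 1)"]
    have box: "m1 (q * (t - 1)) 0 \<in> box {..<n} a ?d" "m1 0 (q * (t - 1)) \<in> box {..<n} a ?d"
      by auto
    show ?thesis
    proof (cases "\<alpha> = 0")
      case False
      then have "v (m1 (q * (t - 1)) 0) \<noteq> 0"
        using qt unfolding v_def P_def by (simp add: m1_def)
      then show ?thesis using box by blast
    next
      case True
      then have "v (m1 0 (q * (t - 1))) \<noteq> 0"
        using qt \<alpha>\<beta>(2) unfolding v_def P_def by (simp add: m1_def)
      then show ?thesis using box by blast
    qed
  qed
  moreover have "(shift {..<n} c 1 ^^ q) v m = 0" if m: "m \<in> box {..<n} a (?d + q)" for m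
  proof -
    have ma: "m i < a i" if "i < n" for i using m that unfolding box_def by auto
    let ?f = "\<lambda>i. if q \<le> m i then C i * v (m(i := m i - q)) else 0"
    have "(shift {..<n} c 1 ^^ q) v m = sum ?f {..<n}"
      unfolding q frobenius_shift_power[OF finite_lessThan p] shift_def C_def ..
    also have "\<dots> = sum ?f {1, 2}"
    proof (intro sum.mono_neutral_right ballI)
      fix i assume i: "i \<in> {..<n} - {1, 2}"
      show "?f i = 0"
      proof (cases "i = 0")
        case True
        \<comment> \<open>Removing T_0^q would leave an exponent below e, off the support of
          v.\<close>
        have "m 0 < q + e" using ma[of 0] n a(2) by simp
        then show ?thesis unfolding True v_def P_def by auto
      next
        case False
        then have "3 \<le> i" using i three[of i] by auto
        then have "m i < q" using ma[of i] i a(6)[of i] by simp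
        then show ?thesis by simp
      qed
    qed (use n in auto)
    also have "\<dots> = ?f 1 + ?f 2" by simp
    also have "\<dots> = 0"
    proof (cases "m 0 = e \<and> (\<forall>i\<ge>3. m i = 0) \<and> q dvd m 1 \<and> q dvd m 2 \<and> m 1 + m 2 = q * t")
      case True
      then obtain x y where xy: "m 1 = q * x" "m 2 = q * y" by (elim conjE dvdE)
      have "q * x < q * t" "q * y < q * t"
        using ma[of 1] ma[of 2] n a(4,5) xy by (simp_all add: mult.commute)
      then have lt: "x < t" "y < t" by simp_all
      have "q * (x + y) = q * t" using True xy by (simp add: distrib_left)
      \<comment> \<open>With x, y < t this forces x, y \<ge> 1, so both summands occur and can
        cancel.\<close>
      then have xyt: "x + y = t" using q0 by simp
      with lt obtain x' y' where x': "x = Suc x'" "y = Suc y'" by (cases x; cases y) auto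
      have 1: "v (m(1 := m 1 - q)) = \<alpha> ^ x' * (- \<beta>) ^ Suc y'"
        using True q0 xyt unfolding v_def P_def by (auto simp: xy[unfolded One_nat_def] x')
      have 2: "v (m(2 := m 2 - q)) = \<alpha> ^ Suc x' * (- \<beta>) ^ y'"
        using True q0 xyt unfolding v_def P_def by (auto simp: xy[unfolded One_nat_def] x')
      have "?f 1 + ?f 2 = \<alpha> ^ x' * (- \<beta>) ^ y' * (C 2 * \<alpha> - C 1 * \<beta>)"
        unfolding 1 2 by (simp add: xy[unfolded One_nat_def] x' algebra_simps)
      then show ?thesis using \<alpha>\<beta>(1) by simp
    next
      case False
      have "\<not> P (m(1 := m 1 - q))" if "q \<le> m 1"
        using False that by (auto simp: P_def dest: dvd_diffD)
      moreover have "\<not> P (m(2 := m 2 - q))" if "q \<le> m 2"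
        using False that by (auto simp: P_def dest: dvd_diffD)
      ultimately show ?thesis by (simp add: v_def)
    qed
    finally show ?thesis .
  qed
  ultimately have "\<exists>d < ?d + q. \<not> lef_inj {..<n} a c d"
    using not_lef_inj_if_killed by blast
  then show ?thesis using qt by (simp add: add.assoc)
qed

section \<open>Arithmetic of the socle degree and the choice of exponents\<close>

lemma socle_degree_cases:
  fixes p s :: nat
  assumes p: "2 \<le> p" and s: "2 * p \<le> s + 1"
  obtains t k r where "1 \<le> t" "t < p" "1 \<le> k" "s + 3 = 2 * t * p ^ k + r" "2 \<le> r" "r + 2 \<le> 2 * p ^ k"
  | t k where "1 \<le> t" "t < p" "1 \<le> k" "(2 * t + 2) * p ^ k - 4 \<le> s" "s \<le> (2 * t + 2) * p ^ k - 2"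
proof -
  have "s + 1 < 2 * p ^ (s + 1)" using power_gt_expt[of p "s + 1"] p by simp
  \<comment> \<open>Minimality gives 2 p^{K-1} \<le> s + 1 < 2 p^K, and 2p \<le> s + 1 forces K
    \<ge> 2.\<close>
  define K where "K = (LEAST K. s + 1 < 2 * p ^ K)"
  have K: "s + 1 < 2 * p ^ K"
    unfolding K_def by (rule LeastI) fact
  have K2: "2 * p ^ j \<le> s + 1" if "j < K" for j
    using not_less_Least[of j "\<lambda>K. s + 1 < 2 * p ^ K"] that unfolding K_def by simp
  have "K \<noteq> 0" "K \<noteq> 1" using K s p by (auto intro: ccontr)
  then obtain k where k: "K = Suc k" "1 \<le> k" by (cases K) auto
  define q where "q = p ^ k"
  have q: "2 * q \<le> s + 1" "s + 1 < 2 * (p * q)"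
    using K K2[of k] k unfolding q_def by simp_all
  have pq: "p \<le> q" using k(2) p unfolding q_def by (simp add: self_le_power)
  \<comment> \<open>s + 3 is the exponent sum for three variables; it is divided by 2q with
    remainder.\<close>
  define t where "t = (s + 3) div (2 * q)"
  define r where "r = (s + 3) mod (2 * q)"
  have tr: "s + 3 = 2 * q * t + r" "r < 2 * q"
    using pq p unfolding t_def r_def by auto
  have t1: "1 \<le> t"
  proof (rule ccontr)
    assume "\<not> 1 \<le> t"
    then have "t = 0" by simp
    then show False using tr q by simp
  qed
  have tp: "t \<le> p"
  proof (rule ccontr)
    assume "\<not> t \<le> p"
    then have "2 * q * (p + 1) \<le> 2 * q * t" by (intro mult_le_mono) auto
    moreover have "2 * q * (p + 1) = 2 * (p * q) + 2 * q" by (simp add: algebra_simps)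
    ultimately show False using tr q pq p by linarith
  qed
  \<comment> \<open>The remainders 0, 1 and 2q - 1 place s + 3 within one of a multiple of 2q. The
    multiplier in the special case is t - 1 for the first two and t for the last.\<close>
  consider "r \<le> 1" | "2 \<le> r" "r + 2 \<le> 2 * q" | "r + 1 = 2 * q" using tr(2) by linarith
  then show thesis
  proof cases
    case 1
    have "t \<noteq> 1"
    proof
      assume "t = 1"
      then show False using tr q 1 by simp
    qed
    then obtain u where u: "t = u + 1" "1 \<le> u" using t1 by (cases t) auto
    have e: "(2 * u + 2) * q = 2 * q * t" by (simp add: u algebra_simps)
    show ?thesis
      by (intro that(2)[of u k], fold q_def) (use e 1 tr u tp k(2) in linarith)+
  next
    case 2
    have "t \<noteq> p"
    proof
      assume "t = p"
      then show False using tr(1) q(2) 2 by (simp add: algebra_simps)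
    qed
    then show ?thesis
      using 2 tr t1 tp k(2) by (intro that(1)[of t k r]) (auto simp: q_def[symmetric] algebra_simps)
  next
    case 3
    have "t \<noteq> p"
    proof
      assume "t = p"
      then show False using tr(1) q pq p 3 by (simp add: algebra_simps)
    qed
    then have "t < p" using tp by simp
    have e: "(2 * t + 2) * q = 2 * q * t + 2 * q" by (simp add: algebra_simps)
    show ?thesis
      by (intro that(2)[of t k], fold q_def) (use e 3 tr t1 \<open>t < p\<close> k(2) in linarith)+
  qed
qed

lemma sum_eventually_one:
  fixes a :: "nat \<Rightarrow> nat"
  assumes "m \<le> n" "\<And>i. m \<le> i \<Longrightarrow> a i = 1"
  shows "sum a {..<n} = sum a {..<m} + (n - m)"
proof -
  have "sum a {..<n} = sum a {..<m} + sum a {m..<n}"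
    using assms(1) by (subst sum.union_disjoint[symmetric]) (auto simp: ivl_disj_un)
  then show ?thesis using assms(2) by simp
qed

lemma exists_not_lef_inj:
  fixes s n p :: nat
  assumes n: "3 \<le> n" and p: "Factorial_Ring.prime p" "p = CHAR('k::field)" and s: "\<not> s \<le> 2 * p - 2"
    and n3: "\<not> (n = 3 \<and> (\<exists>t q k :: nat. 1 \<le> t \<and> t < p \<and> q = p ^ k \<and> q \<ge> p
                    \<and> (2 * t + 2) * q - 4 \<le> s \<and> s \<le> (2 * t + 2) * q - 2))"
    and n4: "\<not> (n = 4 \<and> p = 2 \<and> s = 6)"
  shows "\<exists>a. (\<forall>i<n. 1 \<le> a i) \<and> (\<Sum>i<n. a i) = s + n \<and>
    (\<forall>c :: nat \<Rightarrow> 'k. \<exists>d. 2 * d + 1 \<le> s \<and> \<not> lef_inj {..<n} a c d)"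
proof -
  have p2: "2 \<le> p" using prime_ge_2_nat[OF p(1)] .
  \<comment> \<open>The last condition ensures that every degree d < e + q t satisfies 2d + 1 \<le>
    s, so the failure falls in the half where injectivity is required.\<close>
  have fail: "\<exists>d. 2 * d + 1 \<le> s \<and> \<not> lef_inj {..<n} a c d"
    if "1 \<le> t" "\<And>i. i < n \<Longrightarrow> 1 \<le> a i" "a 0 \<le> p ^ k + e" "e < a 0" "a 1 = t * p ^ k" "a 2 = t * p ^ k"
      "\<And>i. 3 \<le> i \<Longrightarrow> i < n \<Longrightarrow> a i \<le> p ^ k" "2 * (e + p ^ k * t) \<le> s + 1"
    for t k e a and c :: "nat \<Rightarrow> 'k"
  proof -
    have "\<exists>d < e + p ^ k * t. \<not> lef_inj {..<n} a c d"
      using p by (intro not_lef_inj_frobenius[OF n _ _ that(1-7)]) auto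
    then obtain d where "d < e + p ^ k * t" "\<not> lef_inj {..<n} a c d" by blast
    then show ?thesis using that(8) by (intro exI[of _ d]) auto
  qed
  have "2 * p \<le> s + 1" using s by simp
  then show ?thesis
  proof (cases rule: socle_degree_cases[OF p2, consumes 1, case_names generic special])
    case (generic t k r)
    define q where "q = p ^ k"
    have q0: "1 \<le> q" "1 \<le> t * q" using generic p2 unfolding q_def by simp_all
    define a :: "nat \<Rightarrow> nat" where "a i = (if i = 0 then r else if i = 1 \<or> i = 2 then t * q else 1)" for i :: nat
    have "sum a {..<n} = sum a {..<3} + (n - 3)"
      using n by (intro sum_eventually_one) (auto simp: a_def)
    also have "sum a {..<3} = s + 3"
      using generic(4) by (simp add: a_def numeral_eq_Suc lessThan_Suc q_def algebra_simps)
    finally have "sum a {..<n} = s + n" using n by simp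
    moreover have "\<exists>d. 2 * d + 1 \<le> s \<and> \<not> lef_inj {..<n} a c d" for c :: "nat \<Rightarrow> 'k"
    proof (rule fail[of t a k "r - q"])
      \<comment> \<open>For r \<ge> q this is r + 2 \<le> 2q; for r < q the difference is truncated
        to 0 and r \<ge> 2 suffices.\<close>
      have "2 * (r - q) \<le> r - 2" using generic(5,6) unfolding q_def[symmetric] by linarith
      then show "2 * (r - q + p ^ k * t) \<le> s + 1"
        using generic(4,5) unfolding q_def[symmetric] by (simp add: algebra_simps)
    qed (use generic q0 in \<open>auto simp: a_def q_def\<close>)
    moreover have "1 \<le> a i" for i using generic q0 by (simp add: a_def)
    ultimately show ?thesis by blast
  next
    case (special t k)
    define q where "q = p ^ k"
    have q0: "p \<le> q" using special(3) p2 unfolding q_def by (simp add: self_le_power)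
    have tq: "p \<le> t * q" using mult_le_mono[OF special(1) q0] by simp
    have "n \<noteq> 3" using n3 special q0 unfolding q_def by blast
    then have n4': "4 \<le> n" using n by simp
    \<comment> \<open>The offset 0, 1 or 2 of s in its window. A fourth variable with exponent q
      absorbs the remaining sum, and e = E works unless E + 3 > 2q.\<close>
    define E where "E = s + 4 - (2 * t + 2) * q"
    have E: "s + 4 = (2 * t + 2) * q + E" "E \<le> 2"
      using special(4,5) tq p2 unfolding q_def[symmetric] E_def by auto
    show ?thesis
    proof (cases "E + 3 \<le> 2 * q")
      case True
      define a :: "nat \<Rightarrow> nat" where "a i = (if i = 0 then q + E else if i = 1 \<or> i = 2 then t * q else if i = 3 then q else 1)"
        for i :: nat
      have "sum a {..<n} = sum a {..<4} + (n - 4)"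
        using n4' by (intro sum_eventually_one) (auto simp: a_def)
      also have "sum a {..<4} = s + 4"
        using E(1) by (simp add: a_def numeral_eq_Suc lessThan_Suc algebra_simps)
      finally have "sum a {..<n} = s + n" using n4' by simp
      moreover have "\<exists>d. 2 * d + 1 \<le> s \<and> \<not> lef_inj {..<n} a c d" for c :: "nat \<Rightarrow> 'k"
      proof (rule fail[of t a k E])
        show "2 * (E + p ^ k * t) \<le> s + 1"
          using E(1) True unfolding q_def[symmetric] by (simp add: algebra_simps)
      qed (use special q0 tq p2 in \<open>auto simp: a_def q_def[symmetric]\<close>)
      moreover have "1 \<le> a i" for i using q0 tq p2 special(1) by (simp add: a_def)
      ultimately show ?thesis by blast
    next
      case False
      \<comment> \<open>The only obstruction is p = q = 2 with E = 2, hence s = 6. Since n = 4 is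
        excluded, a fifth variable is available.\<close>
      then have q2: "q = 2" "p = 2" "E = 2" using E(2) q0 p2 by linarith+
      then have t: "t = 1" using special by simp
      then have s6: "s = 6" using E(1) q2 by simp
      then have n5: "5 \<le> n" using n4 n4' q2 by linarith
      define a :: "nat \<Rightarrow> nat" where "a i = (if i = 0 then 3 else if i \<le> 4 then 2 else 1)" for i :: nat
      have "sum a {..<n} = sum a {..<5} + (n - 5)"
        using n5 by (intro sum_eventually_one) (auto simp: a_def)
      also have "sum a {..<5} = 11" by (simp add: a_def numeral_eq_Suc lessThan_Suc)
      finally have "sum a {..<n} = s + n" using n5 s6 by simp
      moreover have "\<exists>d. 2 * d + 1 \<le> s \<and> \<not> lef_inj {..<n} a c d" for c :: "nat \<Rightarrow> 'k"
        by (rule fail[of 1 a k 1]) (auto simp: a_def q2(1)[unfolded q_def] s6)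
      moreover have "1 \<le> a i" for i by (simp add: a_def)
      ultimately show ?thesis by blast
    qed
  qed
qed

lemma lef_inj_of_socle_degree:
  fixes s n p :: nat and c :: "nat \<Rightarrow> 'k::field"
  assumes p: "Factorial_Ring.prime p" "p = CHAR('k)"
    and a: "\<And>i. i < n \<Longrightarrow> 1 \<le> a i" "sum a {..<n} = s + n"
    and c: "\<And>i. i < n \<Longrightarrow> c i \<noteq> 0" and d: "2 * d + 1 \<le> s"
    and cond: "s \<le> 2 * p - 2
       \<or> n = 3 \<and> (\<exists>t q k :: nat. 1 \<le> t \<and> t < p \<and> q = p ^ k \<and> q \<ge> p
                    \<and> (2 * t + 2) * q - 4 \<le> s \<and> s \<le> (2 * t + 2) * q - 2)
       \<or> n = 4 \<and> p = 2 \<and> s = 6"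
  shows "lef_inj {..<n} a c d"
proof -
  have p2: "2 \<le> p" using prime_ge_2_nat[OF p(1)] .
  have s: "(\<Sum>i<n. a i - 1) = s"
    using sum_pred[of "{..<n}" a] a by simp
  from cond show ?thesis
  proof (elim disjE conjE exE)
    assume "s \<le> 2 * p - 2"
    \<comment> \<open>2d + 1 \<le> s \<le> 2p - 2 gives d + 1 < p.\<close>
    then have "of_nat j \<noteq> (0 :: 'k)" if "1 \<le> j" "j \<le> Suc d" for j
      using that d nat_dvd_not_less[of j p] unfolding p(2) of_nat_eq_0_iff_char_dvd by auto
    then show ?thesis
      using a(1) c d s by (intro lef_inj_char_large) auto
  next
    fix t q k :: nat
    assume n: "n = 3" and t: "1 \<le> t" "t < p" and q: "q = p ^ k" "p \<le> q"
      and s': "(2 * t + 2) * q - 4 \<le> s" "s \<le> (2 * t + 2) * q - 2"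
    \<comment> \<open>The window for s is 2M - 4 \<le> s \<le> 2M - 2. For its upper two values the
      largest relevant degree is M - 2.\<close>
    define M where "M = p ^ k * (t + 1)"
    have M: "(2 * t + 2) * q = 2 * M" unfolding M_def q by (simp add: algebra_simps)
    have M4: "4 \<le> M" using mult_le_mono[of 2 q 2 "t + 1"] q p2 t unfolding M_def q(1) by simp
    have T: "lef_inj {..<n} b c (M - 2)" if "2 * M \<le> sum b {..<n}" for b
      using that t n c p unfolding M_def by (intro lef_inj_three) auto
    show ?thesis
    proof (cases "2 * M \<le> s + 3")
      case True
      have "lef_inj {..<n} a c (M - 2)" using True a(2) n by (intro T) simp
      then show ?thesis
        by (rule lef_inj_downward[OF finite_lessThan]) (use d s' M M4 s in linarith)+
    next
      case False
      \<comment> \<open>At the lower end the largest relevant degree is M - 3, and the exponent sum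
        is one too small; enlarging a_0 by one repairs both.\<close>
      then have sM: "s + 4 = 2 * M" using s' M M4 by linarith
      have 0: "(0::nat) \<in> {..<n}" using n by simp
      have "sum (a(0 := Suc (a 0))) {..<n} = 2 * M"
        using sum_fun_upd[OF finite_lessThan 0, of a "Suc (a 0)"] a(2) n sM by simp
      moreover have "Suc (M - 3) = M - 2" using M4 by simp
      ultimately have "lef_inj {..<n} (a(0 := Suc (a 0))) c (Suc (M - 3))"
        using T[of "a(0 := Suc (a 0))"] by simp
      then have "lef_inj {..<n} a c (M - 3)"
        by (rule lef_inj_embed[OF finite_lessThan 0])
      then show ?thesis
        by (rule lef_inj_downward[OF finite_lessThan]) (use d sM M4 s in linarith)+
    qed
  next
    assume n: "n = 4" and "p = 2" "s = 6"
    then have "lef_inj {..<n} a c 2"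
      using a c p by (intro lef_inj_four) auto
    then show ?thesis
      by (rule lef_inj_downward[OF finite_lessThan]) (use d \<open>s = 6\<close> s in linarith)+
  qed
qed

section \<open>The quotient ring\<close>

text \<open>Each generator raises the dimension by at most one. Hence a span of full dimension
  certifies that its generating list is independent.\<close>

lemma (in ring) dimension_Span_le:
  assumes K: "subfield K R" and Us: "set Us \<subseteq> carrier R"
  shows "\<exists>n. dimension n K (Span K Us) \<and> n \<le> length Us \<and> (n = length Us \<longrightarrow> independent K Us)"
  using Us
proof (induction Us)
  case (Cons u Us)
  then obtain n where n: "dimension n K (Span K Us)" "n \<le> length Us"
    "n = length Us \<longrightarrow> independent K Us" by auto
  show ?case
  proof (cases "u \<in> Span K Us")
    case True
    have "set (u # Us) \<subseteq> Span K Us"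
      using True Span_base_incl[OF K] Cons.prems by auto
    from mono_Span_subset[OF K this] have "Span K (u # Us) \<subseteq> Span K Us"
      using Cons.prems by simp
    moreover have "Span K Us \<subseteq> Span K (u # Us)"
      using mono_Span[OF K] Cons.prems by auto
    ultimately have "Span K (u # Us) = Span K Us" by blast
    then show ?thesis using n(1,2) by (intro exI[of _ n]) auto
  next
    case False
    have "dimension (Suc n) K (Span K (u # Us))"
      using Suc_dim[OF _ False n(1)] Cons.prems by simp
    then show ?thesis
      using n(2,3) False Cons.prems li_Cons by (intro exI[of _ "Suc n"]) auto
  qed
qed auto

text \<open>The monomials outside the ideal, whose classes form the monomial basis of the
  quotient.\<close>

definition std_monoms :: "nat \<Rightarrow> (nat \<Rightarrow> nat) \<Rightarrow> (nat \<Rightarrow>\<^sub>0 nat) set" where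
  "std_monoms n a =
     {u. Poly_Mapping.keys u \<subseteq> {..<n} \<and> (\<forall>i<n. Poly_Mapping.lookup u i < a i)}"

lemma mpoly_ring_simps [simp]:
  "monoid.mult (mpoly_ring n) = (*)" "monoid.one (mpoly_ring n) = 1"
  "ring.zero (mpoly_ring n) = 0" "ring.add (mpoly_ring n) = (+)"
  by (simp_all add: mpoly_ring_def)

lemma carrier_mpoly_ring:
  "f \<in> carrier (mpoly_ring n) \<longleftrightarrow> (\<forall>m\<in>Poly_Mapping.keys f. Poly_Mapping.keys m \<subseteq> {..<n})"
  by (simp add: mpoly_ring_def)

lemma cring_of_closed:
  fixes S :: "'a::comm_ring_1 set"
  assumes "0 \<in> S" "1 \<in> S" "\<And>x y. x \<in> S \<Longrightarrow> y \<in> S \<Longrightarrow> x + y \<in> S"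
    "\<And>x y. x \<in> S \<Longrightarrow> y \<in> S \<Longrightarrow> x * y \<in> S" "\<And>x. x \<in> S \<Longrightarrow> - x \<in> S"
  shows "cring \<lparr>carrier = S, monoid.mult = (*), one = 1, ring.zero = 0, add = (+)\<rparr>"
proof (rule cringI)
  show "abelian_group \<lparr>carrier = S, monoid.mult = (*), one = 1, ring.zero = 0, add = (+)\<rparr>"
  proof (rule abelian_groupI)
    fix x assume "x \<in> carrier \<lparr>carrier = S, monoid.mult = (*), one = 1, ring.zero = 0, add = (+)\<rparr>"
    then show "\<exists>y\<in>carrier \<lparr>carrier = S, monoid.mult = (*), one = 1, ring.zero = 0, add = (+)\<rparr>.
        y \<oplus>\<^bsub>\<lparr>carrier = S, monoid.mult = (*), one = 1, ring.zero = 0, add = (+)\<rparr>\<^esub> x =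
        \<zero>\<^bsub>\<lparr>carrier = S, monoid.mult = (*), one = 1, ring.zero = 0, add = (+)\<rparr>\<^esub>"
      using assms by (intro bexI[of _ "- x"]) auto
  qed (use assms in \<open>auto simp: add.assoc add.commute\<close>)
  show "comm_monoid \<lparr>carrier = S, monoid.mult = (*), one = 1, ring.zero = 0, add = (+)\<rparr>"
    by (rule comm_monoidI) (use assms in \<open>auto simp: mult.assoc mult.commute\<close>)
qed (auto simp: distrib_right)

lemma keys_add_mpoly:
  "m \<in> Poly_Mapping.keys (f + g) \<Longrightarrow> m \<in> Poly_Mapping.keys f \<or> m \<in> Poly_Mapping.keys g"
  using keys_add[of f g] by blast

lemma mult_closed_mpoly:
  assumes "f \<in> carrier (mpoly_ring n)" "g \<in> carrier (mpoly_ring n)"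
  shows "f * g \<in> carrier (mpoly_ring n)"
  unfolding carrier_mpoly_ring
proof
  fix m assume "m \<in> Poly_Mapping.keys (f * g)"
  then obtain k l where "m = k + l" "k \<in> Poly_Mapping.keys f" "l \<in> Poly_Mapping.keys g"
    using keys_mult[of f g] by blast
  then show "Poly_Mapping.keys m \<subseteq> {..<n}"
    using assms keys_add[of k l] unfolding carrier_mpoly_ring by blast
qed

lemma keys_uminus_mpoly: "Poly_Mapping.keys (- f) = Poly_Mapping.keys (f :: 'k::comm_ring_1 mpoly)"
  by (auto simp: in_keys_iff)

lemma cring_mpoly_ring: "cring (mpoly_ring n :: 'k::comm_ring_1 mpoly ring)"
proof -
  let ?S = "carrier (mpoly_ring n :: 'k mpoly ring)"
  have "cring \<lparr>carrier = ?S, monoid.mult = (*), one = 1, ring.zero = 0, add = (+)\<rparr>"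
  proof (rule cring_of_closed)
    show "f * g \<in> ?S" if "f \<in> ?S" "g \<in> ?S" for f g using that by (rule mult_closed_mpoly)
  qed (auto simp: carrier_mpoly_ring keys_uminus_mpoly dest!: keys_add_mpoly)
  then show ?thesis by (simp add: mpoly_ring_def)
qed

lemma mpoly_ring_minus:
  assumes "f \<in> carrier (mpoly_ring n)"
  shows "\<ominus>\<^bsub>mpoly_ring n\<^esub> f = (- f :: 'k::comm_ring_1 mpoly)"
proof -
  interpret cring "mpoly_ring n :: 'k mpoly ring" by (rule cring_mpoly_ring)
  show ?thesis
    using assms by (intro minus_equality) (auto simp: carrier_mpoly_ring keys_uminus_mpoly)
qed

lemma single_in_carrier [simp]:
  "Poly_Mapping.keys u \<subseteq> {..<n} \<Longrightarrow> Poly_Mapping.single u x \<in> carrier (mpoly_ring n)"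
  by (auto simp: carrier_mpoly_ring)

lemma Const_in_carrier [simp]: "Const x \<in> carrier (mpoly_ring n)"
  by (simp add: Const_def)

lemma Var_in_carrier [simp]: "i < n \<Longrightarrow> Var i \<in> carrier (mpoly_ring n)"
  by (simp add: Var_def)

lemma sum_in_carrier:
  "(\<And>x. x \<in> A \<Longrightarrow> f x \<in> carrier (mpoly_ring n)) \<Longrightarrow> sum f A \<in> carrier (mpoly_ring n)"
proof (induction A rule: infinite_finite_induct)
  case (insert x A)
  then show ?case by (auto simp: carrier_mpoly_ring dest!: keys_add_mpoly)
qed (auto simp: carrier_mpoly_ring)

lemma Var_power: "Var i ^ k = (Poly_Mapping.single (Poly_Mapping.single i k) 1 :: 'k::comm_ring_1 mpoly)"
  by (induction k) (simp_all add: Var_def mult_single single_add[symmetric] single_one)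

lemma mpoly_as_sum:
  "f = (\<Sum>u\<in>Poly_Mapping.keys f. Poly_Mapping.single u (Poly_Mapping.lookup f u))"
  by (rule poly_mapping_eqI) (auto simp: lookup_sum lookup_single when_def in_keys_iff)

text \<open>Divisors of standard monomials are standard, so the right-hand side is an ideal; it
  contains the generators. Conversely every nonstandard monomial is a multiple of some
  T_i^{a_i}.\<close>

lemma mci_ideal_eq:
  "mci_ideal n a = {f \<in> carrier (mpoly_ring n). \<forall>u\<in>std_monoms n a. Poly_Mapping.lookup f u = (0 :: 'k::field)}"
  (is "_ = ?J")
proof
  let ?R = "mpoly_ring n :: 'k mpoly ring"
  let ?G = "(\<lambda>i. Var i ^ a i) ` {..<n} :: 'k mpoly set"
  interpret cring ?R by (rule cring_mpoly_ring)
  have G: "?G \<subseteq> carrier ?R" by (auto simp: Var_power split: if_splits)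
  have closed: "x * f \<in> ?J" if f: "f \<in> ?J" and x: "x \<in> carrier ?R" for f x
  proof -
    have "Poly_Mapping.lookup (x * f) u = 0" if u: "u \<in> std_monoms n a" for u
    proof (rule ccontr)
      assume "Poly_Mapping.lookup (x * f) u \<noteq> 0"
      then have "u \<in> Poly_Mapping.keys (x * f)" by (simp add: in_keys_iff)
      then obtain k l where kl: "u = k + l" "k \<in> Poly_Mapping.keys x" "l \<in> Poly_Mapping.keys f"
        using keys_mult[of x f] by blast
      have "l \<in> std_monoms n a"
        using f kl(3) u unfolding std_monoms_def kl(1)
        by (auto simp: carrier_mpoly_ring lookup_add intro: le_less_trans[OF le_add2])
      then show False using f kl(3) by (auto simp: in_keys_iff)
    qed
    then show ?thesis using f x by (auto intro: mult_closed_mpoly)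
  qed
  have "ideal ?J ?R"
  proof (rule idealI)
    show "ring ?R" by (rule ring_axioms)
    show "subgroup ?J (add_monoid ?R)"
    proof (rule add.subgroupI)
      show "\<ominus>\<^bsub>?R\<^esub> f \<in> ?J" if "f \<in> ?J" for f
        using that by (auto simp: mpoly_ring_minus carrier_mpoly_ring keys_uminus_mpoly)
    next
      have "0 \<in> ?J" by (auto simp: carrier_mpoly_ring)
      then show "?J \<noteq> {}" by blast
    qed (auto simp: lookup_add carrier_mpoly_ring dest!: keys_add_mpoly)
    show "x \<otimes>\<^bsub>?R\<^esub> f \<in> ?J" if "f \<in> ?J" "x \<in> carrier ?R" for f x
      using closed[OF that] by simp
    show "f \<otimes>\<^bsub>?R\<^esub> x \<in> ?J" if "f \<in> ?J" "x \<in> carrier ?R" for f x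
      using closed[OF that] by (simp add: mult.commute)
  qed
  moreover have "?G \<subseteq> ?J"
  proof
    fix g assume "g \<in> ?G"
    then obtain i where i: "i < n" "g = Var i ^ a i" by auto
    have "Poly_Mapping.single i (a i) \<noteq> u" if "u \<in> std_monoms n a" for u
      using that i(1) by (auto simp: std_monoms_def)
    then show "g \<in> ?J"
      using G i by (auto simp: Var_power lookup_single_not_eq)
  qed
  ultimately show "mci_ideal n a \<subseteq> ?J"
    unfolding mci_ideal_def by (rule genideal_minimal)
  interpret I: ideal "mci_ideal n a" ?R
    unfolding mci_ideal_def using G by (rule genideal_ideal)
  show "?J \<subseteq> mci_ideal n a"
  proof
    fix f assume f: "f \<in> ?J"
    have single: "Poly_Mapping.single u (Poly_Mapping.lookup f u) \<in> mci_ideal n a"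
      if u: "u \<in> Poly_Mapping.keys f" for u
    proof -
      have k: "Poly_Mapping.keys u \<subseteq> {..<n}" using f u by (auto simp: carrier_mpoly_ring)
      have "u \<notin> std_monoms n a" using f u by (auto simp: in_keys_iff)
      then obtain i where i: "i < n" "a i \<le> Poly_Mapping.lookup u i"
        using k by (auto simp: std_monoms_def not_less)
      define w where "w = u - Poly_Mapping.single i (a i)"
      have uw: "u = w + Poly_Mapping.single i (a i)"
        unfolding w_def using i(2)
        by (intro poly_mapping_eqI) (auto simp: lookup_add lookup_minus lookup_single when_def)
      have "Poly_Mapping.keys w \<subseteq> Poly_Mapping.keys u"
        unfolding uw by (auto simp: in_keys_iff lookup_add)
      then have "Poly_Mapping.single w (Poly_Mapping.lookup f u) \<in> carrier ?R"
        using k by (intro single_in_carrier) blast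
      moreover have "(Var i ^ a i :: 'k mpoly) \<in> mci_ideal n a"
        unfolding mci_ideal_def
        by (rule subsetD[OF genideal_self[OF G]], rule imageI) (use i(1) in simp)
      ultimately have "Poly_Mapping.single w (Poly_Mapping.lookup f u) * Var i ^ a i \<in> mci_ideal n a"
        using I.I_l_closed[of "Var i ^ a i"] by simp
      then show ?thesis by (simp add: Var_power mult_single flip: uw)
    qed
    have "(\<Sum>u\<in>A. Poly_Mapping.single u (Poly_Mapping.lookup f u)) \<in> mci_ideal n a"
      if "finite A" "A \<subseteq> Poly_Mapping.keys f" for A
      using that
    proof (induction A rule: finite_induct)
      case empty
      then show ?case using additive_subgroup.zero_closed[OF I.additive_subgroup_axioms] by simp
    next
      case (insert x A)
      then show ?case
        using additive_subgroup.a_closed[OF I.additive_subgroup_axioms single[of x]] by simp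
    qed
    from this[OF finite_keys order.refl] show "f \<in> mci_ideal n a"
      unfolding mpoly_as_sum[of f, symmetric] .
  qed
qed

lemma ideal_mci: "ideal (mci_ideal n a) (mpoly_ring n :: 'k::field mpoly ring)"
proof -
  interpret cring "mpoly_ring n :: 'k mpoly ring" by (rule cring_mpoly_ring)
  show ?thesis
    unfolding mci_ideal_def by (rule genideal_ideal) (auto simp: Var_power split: if_splits)
qed

lemma mci_class_hom: "ring_hom_ring (mpoly_ring n) (mci n a) (mci_class n a :: 'k::field mpoly \<Rightarrow> _)"
  using ideal.rcos_ring_hom_ring[OF ideal_mci] unfolding mci_def mci_class_def[abs_def] .

lemma cring_mci: "cring (mci n a :: 'k::field mpoly set ring)"
  unfolding mci_def by (rule ideal.quotient_is_cring[OF ideal_mci cring_mpoly_ring])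

lemma mci_class_closed [simp]:
  "f \<in> carrier (mpoly_ring n) \<Longrightarrow> mci_class n a f \<in> carrier (mci n a :: 'k::field mpoly set ring)"
  using ring_hom_closed[OF ring_hom_ring.homh[OF mci_class_hom]] by blast

lemma mci_class_mult:
  assumes "f \<in> carrier (mpoly_ring n)" "g \<in> carrier (mpoly_ring n)"
  shows "mci_class n a f \<otimes>\<^bsub>mci n a\<^esub> mci_class n a g = mci_class n a (f * g :: 'k::field mpoly)"
  using ring_hom_mult[OF ring_hom_ring.homh[OF mci_class_hom] assms] by simp

lemma mci_class_add:
  assumes "f \<in> carrier (mpoly_ring n)" "g \<in> carrier (mpoly_ring n)"
  shows "mci_class n a f \<oplus>\<^bsub>mci n a\<^esub> mci_class n a g = mci_class n a (f + g :: 'k::field mpoly)"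
  using ring_hom_add[OF ring_hom_ring.homh[OF mci_class_hom] assms] by simp

lemma mci_class_zero: "mci_class n a 0 = \<zero>\<^bsub>mci n a :: 'k::field mpoly set ring\<^esub>"
proof -
  interpret ring_hom_ring "mpoly_ring n :: 'k mpoly ring" "mci n a" "mci_class n a"
    by (rule mci_class_hom)
  show ?thesis using hom_zero by simp
qed

lemma mci_class_one: "mci_class n a 1 = \<one>\<^bsub>mci n a :: 'k::field mpoly set ring\<^esub>"
  using ring_hom_one[OF ring_hom_ring.homh[OF mci_class_hom, of n a]] by simp

lemma mci_class_eq_iff:
  fixes f g :: "'k::field mpoly"
  assumes f: "f \<in> carrier (mpoly_ring n)" and g: "g \<in> carrier (mpoly_ring n)"
  shows "mci_class n a f = mci_class n a g \<longleftrightarrow>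
    (\<forall>u\<in>std_monoms n a. Poly_Mapping.lookup f u = Poly_Mapping.lookup g u)"
proof -
  let ?R = "mpoly_ring n :: 'k mpoly ring"
  interpret cring ?R by (rule cring_mpoly_ring)
  have fg: "f \<ominus>\<^bsub>?R\<^esub> g = f - g" using g by (simp add: a_minus_def mpoly_ring_minus)
  have "f - g \<in> carrier ?R" using minus_closed[OF f g] fg by simp
  then have "f - g \<in> mci_ideal n a \<longleftrightarrow>
      (\<forall>u\<in>std_monoms n a. Poly_Mapping.lookup f u = Poly_Mapping.lookup g u)"
    by (simp only: mci_ideal_eq lookup_minus right_minus_eq mem_Collect_eq simp_thms)
  moreover have "f - g \<in> mci_ideal n a \<longleftrightarrow> mci_class n a f = mci_class n a g"
    using quotient_eq_iff_same_a_r_cos[OF ideal_mci f g] unfolding fg mci_class_def .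
  ultimately show ?thesis by simp
qed

section \<open>Dimensions of graded pieces\<close>

lemma Const_simps:
  "Const 0 = 0" "Const 1 = 1" "Const (x + y) = Const x + Const y" "Const (x * y) = Const x * Const y"
  "Const (- x) = - Const x"
  by (simp_all add: Const_def single_add mult_single single_uminus)

lemma zero_in_std_monoms: "(\<And>i. i < n \<Longrightarrow> 1 \<le> a i) \<Longrightarrow> 0 \<in> std_monoms n a"
  by (force simp: std_monoms_def)

lemma mci_class_Const_eq_zero_iff:
  fixes x :: "'k::field"
  assumes "\<And>i. i < n \<Longrightarrow> 1 \<le> a i"
  shows "mci_class n a (Const x) = \<zero>\<^bsub>mci n a\<^esub> \<longleftrightarrow> x = 0"
proof -
  have "mci_class n a (Const x) = mci_class n a 0 \<longleftrightarrow> x = 0"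
    using zero_in_std_monoms[OF assms]
    by (subst mci_class_eq_iff) (auto simp: carrier_mpoly_ring Const_def lookup_single when_def)
  then show ?thesis by (simp add: mci_class_zero)
qed

lemma subfield_scalars:
  assumes a: "\<And>i. i < n \<Longrightarrow> 1 \<le> a i"
  shows "subfield (mci_scalars n a) (mci n a :: 'k::field mpoly set ring)"
proof -
  let ?R = "mpoly_ring n :: 'k mpoly ring" and ?S = "range (Const :: 'k \<Rightarrow> 'k mpoly)"
  interpret ring_hom_ring ?R "mci n a" "mci_class n a" by (rule mci_class_hom)
  have R: "?R\<lparr>carrier := ?S\<rparr> = \<lparr>carrier = ?S, monoid.mult = (*), one = 1, ring.zero = 0, add = (+)\<rparr>"
    by (simp add: mpoly_ring_def)
  have "cring (?R\<lparr>carrier := ?S\<rparr>)"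
    unfolding R
  proof (rule cring_of_closed)
    show "0 \<in> ?S" "1 \<in> ?S" by (metis Const_simps(1) rangeI, metis Const_simps(2) rangeI)
  qed (auto simp flip: Const_simps)
  then interpret K: cring "?R\<lparr>carrier := ?S\<rparr>" .
  have "field (?R\<lparr>carrier := ?S\<rparr>)"
  proof (rule K.cring_fieldI2)
    fix f assume "f \<in> carrier (?R\<lparr>carrier := ?S\<rparr>)" "f \<noteq> \<zero>\<^bsub>?R\<lparr>carrier := ?S\<rparr>\<^esub>"
    then obtain x where x: "f = Const x" "Const x \<noteq> (0 :: 'k mpoly)" by auto
    then have "x \<noteq> 0" by (auto simp: Const_simps)
    with x have "f * Const (inverse x) = 1" by (simp add: Const_simps(2) flip: Const_simps(4))
    then show "\<exists>g\<in>carrier (?R\<lparr>carrier := ?S\<rparr>). f \<otimes>\<^bsub>?R\<lparr>carrier := ?S\<rparr>\<^esub> g = \<one>\<^bsub>?R\<lparr>carrier := ?S\<rparr>\<^esub>"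
      by auto
  qed simp
  then have "subfield ?S ?R"
    by (rule R.subfield_iff(1)) auto
  moreover have "\<one>\<^bsub>mci n a :: 'k mpoly set ring\<^esub> \<noteq> \<zero>\<^bsub>mci n a\<^esub>"
  proof -
    have "mci_class n a (Const (1 :: 'k)) = \<zero>\<^bsub>mci n a\<^esub> \<longleftrightarrow> (1 :: 'k) = 0"
      by (rule mci_class_Const_eq_zero_iff[OF a])
    then show ?thesis by (simp add: Const_simps mci_class_one)
  qed
  ultimately show ?thesis
    unfolding mci_scalars_def by (rule img_is_subfield(2))
qed

definition std_monoms_deg :: "nat \<Rightarrow> (nat \<Rightarrow> nat) \<Rightarrow> nat \<Rightarrow> (nat \<Rightarrow>\<^sub>0 nat) set" where
  "std_monoms_deg n a d = {u \<in> std_monoms n a. (\<Sum>i<n. Poly_Mapping.lookup u i) = d}"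

definition box_poly :: "nat \<Rightarrow> (nat \<Rightarrow> nat) \<Rightarrow> nat \<Rightarrow> ((nat \<Rightarrow> nat) \<Rightarrow> 'k) \<Rightarrow> 'k::field mpoly" where
  "box_poly n a d w =
     (\<Sum>u\<in>std_monoms_deg n a d. Poly_Mapping.single u (w (Poly_Mapping.lookup u)))"

lemma std_monoms_deg_iff:
  "u \<in> std_monoms_deg n a d \<longleftrightarrow> Poly_Mapping.lookup u \<in> box {..<n} a d"
proof -
  have "Poly_Mapping.keys u \<subseteq> {..<n} \<longleftrightarrow> (\<forall>i. i \<notin> {..<n} \<longrightarrow> Poly_Mapping.lookup u i = 0)"
    by (auto simp: in_keys_iff subset_eq)
  then show ?thesis by (auto simp: std_monoms_deg_def std_monoms_def box_def)
qed

lemma finite_support_box: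
  fixes n :: nat
  assumes "m \<in> box {..<n} a d"
  shows "finite {i. m i \<noteq> 0}"
proof (rule finite_subset)
  show "{i. m i \<noteq> 0} \<subseteq> {..<n}" using assms unfolding box_def by auto
qed simp

lemma lookup_image_std_monoms_deg:
  "Poly_Mapping.lookup ` std_monoms_deg n a d = box {..<n} a d"
proof
  show "box {..<n} a d \<subseteq> Poly_Mapping.lookup ` std_monoms_deg n a d"
  proof
    fix m assume m: "m \<in> box {..<n} a d"
    then have "Poly_Mapping.lookup (Abs_poly_mapping m) = m"
      by (intro lookup_Abs_poly_mapping finite_support_box)
    then show "m \<in> Poly_Mapping.lookup ` std_monoms_deg n a d"
      using m by (intro image_eqI[of _ _ "Abs_poly_mapping m"]) (simp_all add: std_monoms_deg_iff)
  qed
qed (auto simp: std_monoms_deg_iff)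

lemma bij_betw_lookup_std_monoms_deg:
  "bij_betw Poly_Mapping.lookup (std_monoms_deg n a d) (box {..<n} a d)"
  unfolding bij_betw_def
  using lookup_image_std_monoms_deg by (intro conjI inj_onI poly_mapping_eqI) (auto dest: fun_cong)

lemma finite_std_monoms_deg: "finite (std_monoms_deg n a d)"
  using bij_betw_finite[OF bij_betw_lookup_std_monoms_deg] finite_box[of "{..<n}"] by simp

lemma lookup_box_poly:
  "Poly_Mapping.lookup (box_poly n a d w) u =
     (if u \<in> std_monoms_deg n a d then w (Poly_Mapping.lookup u) else 0)"
  using finite_std_monoms_deg[of n a d]
  by (simp add: box_poly_def lookup_sum lookup_single when_def)

lemma keys_std_monoms_deg: "u \<in> std_monoms_deg n a d \<Longrightarrow> Poly_Mapping.keys u \<subseteq> {..<n}"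
  by (simp add: std_monoms_deg_def std_monoms_def)

lemma box_poly_in_carrier [simp]: "box_poly n a d w \<in> carrier (mpoly_ring n)"
  unfolding box_poly_def by (intro sum_in_carrier single_in_carrier keys_std_monoms_deg)

lemma combine_classes:
  fixes g :: "'k::field mpoly"
  assumes g: "g \<in> carrier (mpoly_ring n)" and "distinct us"
    and "\<And>u. u \<in> set us \<Longrightarrow> Poly_Mapping.keys u \<subseteq> {..<n}"
  shows "ring.combine (mci n a) (map (\<lambda>u. mci_class n a (Const (w (Poly_Mapping.lookup u)))) us)
      (map (\<lambda>u. mci_class n a (g * Poly_Mapping.single u 1)) us)
    = mci_class n a (g * (\<Sum>u\<in>set us. Poly_Mapping.single u (w (Poly_Mapping.lookup u))))"
proof -
  interpret cring "mci n a :: 'k mpoly set ring" by (rule cring_mci)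
  show ?thesis using assms(2,3)
  proof (induction us)
    case Nil
    then show ?case by (simp add: mci_class_zero)
  next
    case (Cons u us)
    let ?S = "\<Sum>u\<in>set us. Poly_Mapping.single u (w (Poly_Mapping.lookup u))"
    have S: "?S \<in> carrier (mpoly_ring n)" using Cons.prems(2) by (intro sum_in_carrier) simp
    have u: "g * Poly_Mapping.single u 1 \<in> carrier (mpoly_ring n)"
      using Cons.prems(2) g by (intro mult_closed_mpoly) simp_all
    have "Const x * (g * Poly_Mapping.single u 1) = g * Poly_Mapping.single u x" for x
      by (simp add: Const_def mult_single mult.left_commute)
    then have "Const (w (Poly_Mapping.lookup u)) * (g * Poly_Mapping.single u 1) + g * ?S =
        g * (\<Sum>u\<in>set (u # us). Poly_Mapping.single u (w (Poly_Mapping.lookup u)))"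
      using Cons.prems(1) by (simp add: distrib_left)
    then show ?case
      using Cons.IH Cons.prems u mult_closed_mpoly[OF g S]
        mult_closed_mpoly[OF Const_in_carrier u]
      by (simp add: mci_class_mult mci_class_add)
  qed
qed

text \<open>Lifts abstract scalars to coefficients in k; distinctness of the monomials makes the
  assignment consistent.\<close>

lemma scalars_as_map:
  assumes "set Ks \<subseteq> mci_scalars n a" "length Ks = length us" "distinct us"
  shows "\<exists>w :: (nat \<Rightarrow> nat) \<Rightarrow> 'k::field.
    Ks = map (\<lambda>u. mci_class n a (Const (w (Poly_Mapping.lookup u)))) us"
  using assms(2,1,3)
proof (induction Ks us rule: list_induct2)
  case (Cons k Ks u us)
  then obtain w where w: "Ks = map (\<lambda>u. mci_class n a (Const (w (Poly_Mapping.lookup u)))) us"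
    by auto
  obtain x where "k = mci_class n a (Const x)" using Cons.prems(1) by (auto simp: mci_scalars_def)
  then show ?case
    using w Cons.prems(2)
    by (intro exI[of _ "w(Poly_Mapping.lookup u := x)"]) (auto simp: lookup_inject)
qed simp

text \<open>With g = 1 this gives the dimension of a graded piece, with g a linear form the rank of
  multiplication. The products of g with the monomials of degree d span \<open>E\<close>, and the
  dimension reaches their number exactly when they are independent.\<close>

lemma mci_dim_multiples:
  fixes g :: "'k::field mpoly" and n d :: nat and a :: "nat \<Rightarrow> nat"
  assumes a: "\<And>i. i < n \<Longrightarrow> 1 \<le> a i" and g: "g \<in> carrier (mpoly_ring n)"
  defines "E \<equiv> range (\<lambda>w. mci_class n a (g * box_poly n a d w))"
    and "injective \<equiv> (\<forall>w :: (nat \<Rightarrow> nat) \<Rightarrow> 'k.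
      (\<forall>u\<in>std_monoms n a. Poly_Mapping.lookup (g * box_poly n a d w) u = 0) \<longrightarrow>
      (\<forall>m\<in>box {..<n} a d. w m = 0))"
  shows "mci_dim n a E = card (box {..<n} a d) \<longleftrightarrow> injective"
proof -
  let ?A = "mci n a :: 'k mpoly set ring" and ?K = "mci_scalars n a :: 'k mpoly set set"
  interpret cring ?A by (rule cring_mci)
  have K: "subfield ?K ?A" by (rule subfield_scalars[OF a])
  obtain us where us: "set us = std_monoms_deg n a d" "distinct us"
    using finite_distinct_list[OF finite_std_monoms_deg] by blast
  define Us where "Us = map (\<lambda>u. mci_class n a (g * Poly_Mapping.single u 1)) us"
  define coeffs where "coeffs w = map (\<lambda>u. mci_class n a (Const (w (Poly_Mapping.lookup u)))) us"
    for w :: "(nat \<Rightarrow> nat) \<Rightarrow> 'k"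
  have Us: "set Us \<subseteq> carrier ?A"
    unfolding Us_def using us(1) g
    by (auto intro!: mci_class_closed mult_closed_mpoly single_in_carrier dest: keys_std_monoms_deg)
  have len: "length Us = card (box {..<n} a d)"
    using us bij_betw_same_card[OF bij_betw_lookup_std_monoms_deg, of n a d] distinct_card[OF us(2)]
    by (simp add: Us_def)
  have comb: "combine (coeffs w) Us = mci_class n a (g * box_poly n a d w)" for w
    unfolding coeffs_def Us_def box_poly_def us(1)[symmetric]
    by (rule combine_classes[OF g us(2)]) (use us(1) keys_std_monoms_deg in blast)
  have coeffs: "set (coeffs w) \<subseteq> ?K" "length (coeffs w) = length Us" for w
    by (auto simp: coeffs_def mci_scalars_def Us_def)
  have ex_coeffs: "\<exists>w. Ks = coeffs w" if "set Ks \<subseteq> ?K" "length Ks = length Us" for Ks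
    unfolding coeffs_def using that us(2) by (intro scalars_as_map) (auto simp: Us_def)
  have Span: "Span ?K Us = E"
  proof
    show "Span ?K Us \<subseteq> E"
    proof
      fix x assume "x \<in> Span ?K Us"
      then obtain Ks where "set Ks \<subseteq> ?K" "length Ks = length Us" "x = combine Ks Us"
        unfolding Span_mem_iff_length_version[OF K Us] by blast
      then show "x \<in> E" using ex_coeffs comb unfolding E_def by blast
    qed
    show "E \<subseteq> Span ?K Us"
    proof
      fix x assume "x \<in> E"
      then obtain w where "x = combine (coeffs w) Us" using comb unfolding E_def by auto
      then show "x \<in> Span ?K Us"
        unfolding Span_mem_iff_length_version[OF K Us] using coeffs[of w] by blast
    qed
  qed
  have zero: "combine (coeffs w) Us = \<zero>\<^bsub>?A\<^esub> \<longleftrightarrow>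
      (\<forall>u\<in>std_monoms n a. Poly_Mapping.lookup (g * box_poly n a d w) u = 0)" for w
    unfolding comb mci_class_zero[symmetric]
    using mult_closed_mpoly[OF g box_poly_in_carrier]
    by (subst mci_class_eq_iff) (auto simp: carrier_mpoly_ring)
  have trivial: "set (coeffs w) \<subseteq> {\<zero>\<^bsub>?A\<^esub>} \<longleftrightarrow> (\<forall>m\<in>box {..<n} a d. w m = 0)" for w
  proof -
    have "mci_class n a (Const x) = \<zero>\<^bsub>?A\<^esub> \<longleftrightarrow> x = 0" for x
      by (rule mci_class_Const_eq_zero_iff[OF a])
    then show ?thesis
      unfolding coeffs_def lookup_image_std_monoms_deg[symmetric] us(1)[symmetric]
      by (simp add: image_subset_iff)
  qed
  have indep: "independent ?K Us \<longleftrightarrow> injective"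
  proof
    assume ind: "independent ?K Us"
    show injective
      unfolding injective_def
    proof (intro allI impI)
      fix w :: "(nat \<Rightarrow> nat) \<Rightarrow> 'k"
      assume "\<forall>u\<in>std_monoms n a. Poly_Mapping.lookup (g * box_poly n a d w) u = 0"
      then have "combine (coeffs w) Us = \<zero>\<^bsub>?A\<^esub>" using zero by simp
      then have "set (take (length Us) (coeffs w)) \<subseteq> {\<zero>\<^bsub>?A\<^esub>}"
        using independent_imp_trivial_combine[OF K ind] coeffs by blast
      then show "\<forall>m\<in>box {..<n} a d. w m = 0" using trivial coeffs(2) by simp
    qed
  next
    assume injective: injective
    show "independent ?K Us"
    proof (rule trivial_combine_imp_independent[OF K Us])
      fix Ks assume Ks: "set Ks \<subseteq> ?K" "combine Ks Us = \<zero>\<^bsub>?A\<^esub>"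
      have KA: "?K \<subseteq> carrier ?A" "\<zero>\<^bsub>?A\<^esub> \<in> ?K"
        using subfieldE(3)[OF K] subringE(2)[OF subfieldE(1)[OF K]] by auto
      \<comment> \<open>\<open>combine\<close> accepts coefficient lists of any length. Truncating
        or padding with zeros produces a list of the length of \<open>Us\<close>, which then comes
        from some w.\<close>
      obtain Ks' where Ks': "set (take (length Us) Ks) \<subseteq> set Ks'"
        "set Ks' \<subseteq> set (take (length Us) Ks) \<union> {\<zero>\<^bsub>?A\<^esub>}" "length Ks' = length Us"
        "combine Ks' Us = \<zero>\<^bsub>?A\<^esub>"
        using combine_normalize[OF _ Us Ks(2)] Ks(1) KA(1) by blast
      have "set Ks' \<subseteq> ?K" using Ks'(2) Ks(1) KA(2) set_take_subset[of "length Us" Ks] by auto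
      then obtain w where w: "Ks' = coeffs w" using ex_coeffs Ks'(3) by blast
      then have "\<forall>m\<in>box {..<n} a d. w m = 0"
        using Ks'(4) zero injective unfolding injective_def by blast
      then show "set (take (length Us) Ks) \<subseteq> {\<zero>\<^bsub>?A\<^esub>}"
        using trivial[of w] Ks'(1) w by auto
    qed
  qed
  obtain k where k: "dimension k ?K (Span ?K Us)" "k \<le> length Us" "k = length Us \<longrightarrow> independent ?K Us"
    using dimension_Span_le[OF K Us] by blast
  have dim: "mci_dim n a E = k" if "dimension k ?K (Span ?K Us)" for k
    using dimI[OF K that] unfolding mci_dim_def over_def Span by simp
  show "mci_dim n a E = card (box {..<n} a d) \<longleftrightarrow> injective"
    using dim[OF k(1)] k(3) len indep dim[OF dimension_independent] by auto
qed

lemma homogeneous_iff: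
  assumes "f \<in> carrier (mpoly_ring n)"
  shows "homogeneous d f \<longleftrightarrow> (\<forall>u\<in>Poly_Mapping.keys f. (\<Sum>i<n. Poly_Mapping.lookup u i) = d)"
proof -
  have "(\<Sum>i\<in>Poly_Mapping.keys u. Poly_Mapping.lookup u i) = (\<Sum>i<n. Poly_Mapping.lookup u i)"
    if "u \<in> Poly_Mapping.keys f" for u
    using assms that by (intro sum.mono_neutral_left) (auto simp: carrier_mpoly_ring in_keys_iff)
  then show ?thesis by (simp add: homogeneous_def)
qed

text \<open>Dropping the nonstandard monomials of a form does not change its class.\<close>

lemma graded_piece_eq:
  "graded_piece n a d = range (\<lambda>w :: (nat \<Rightarrow> nat) \<Rightarrow> 'k::field. mci_class n a (box_poly n a d w))"
proof
  show "graded_piece n a d \<subseteq> range (\<lambda>w :: (nat \<Rightarrow> nat) \<Rightarrow> 'k. mci_class n a (box_poly n a d w))"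
  proof
    fix x :: "'k mpoly set" assume "x \<in> graded_piece n a d"
    then obtain f where f: "f \<in> carrier (mpoly_ring n)" "homogeneous d f" "x = mci_class n a f"
      by (auto simp: graded_piece_def)
    have "Poly_Mapping.lookup f u =
        Poly_Mapping.lookup (box_poly n a d (\<lambda>m. Poly_Mapping.lookup f (Abs_poly_mapping m))) u"
      if "u \<in> std_monoms n a" for u
      using f(2) that unfolding homogeneous_iff[OF f(1)] lookup_box_poly std_monoms_deg_def
      by (auto simp: lookup_inverse in_keys_iff)
    then have "x = mci_class n a (box_poly n a d (\<lambda>m. Poly_Mapping.lookup f (Abs_poly_mapping m)))"
      using f by (simp add: mci_class_eq_iff)
    then show "x \<in> range (\<lambda>w :: (nat \<Rightarrow> nat) \<Rightarrow> 'k. mci_class n a (box_poly n a d w))" by blast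
  qed
  have "homogeneous d (box_poly n a d w :: 'k mpoly)" for w
    unfolding homogeneous_iff[OF box_poly_in_carrier]
    by (auto simp: in_keys_iff lookup_box_poly std_monoms_deg_def split: if_splits)
  then show "range (\<lambda>w :: (nat \<Rightarrow> nat) \<Rightarrow> 'k. mci_class n a (box_poly n a d w)) \<subseteq> graded_piece n a d"
    by (auto simp: graded_piece_def)
qed

lemma mci_dim_graded_piece:
  assumes "\<And>i. i < n \<Longrightarrow> 1 \<le> a i"
  shows "mci_dim n a (graded_piece n a d :: 'k::field mpoly set set) = card (box {..<n} a d)"
proof -
  have "w m = 0" if "\<forall>u\<in>std_monoms n a. Poly_Mapping.lookup (1 * box_poly n a d w) u = 0"
    "m \<in> box {..<n} a d" for w :: "(nat \<Rightarrow> nat) \<Rightarrow> 'k" and m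
  proof -
    from that(2) obtain u where u: "m = Poly_Mapping.lookup u" "u \<in> std_monoms_deg n a d"
      unfolding lookup_image_std_monoms_deg[symmetric] by blast
    then have "u \<in> std_monoms n a" by (simp add: std_monoms_deg_def)
    then show ?thesis using that(1) u by (auto simp: lookup_box_poly)
  qed
  moreover have "(1 :: 'k mpoly) \<in> carrier (mpoly_ring n)" by (simp add: carrier_mpoly_ring)
  from mci_dim_multiples[of n a, OF assms this]
  have "mci_dim n a (range (\<lambda>w :: (nat \<Rightarrow> nat) \<Rightarrow> 'k. mci_class n a (1 * box_poly n a d w))) =
      card (box {..<n} a d) \<longleftrightarrow>
      (\<forall>w :: (nat \<Rightarrow> nat) \<Rightarrow> 'k.
        (\<forall>u\<in>std_monoms n a. Poly_Mapping.lookup (1 * box_poly n a d w) u = 0) \<longrightarrow>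
        (\<forall>m\<in>box {..<n} a d. w m = 0))" .
  ultimately show ?thesis unfolding graded_piece_eq by simp
qed

section \<open>Multiplication by a linear form in the quotient, expressed through
  \<open>shift\<close>\<close>

abbreviation linear_poly :: "nat \<Rightarrow> (nat \<Rightarrow> 'k) \<Rightarrow> 'k::field mpoly" where
  "linear_poly n c \<equiv> (\<Sum>i<n. Const (c i) * Var i)"

lemma linear_poly_in_carrier [simp]: "linear_poly n c \<in> carrier (mpoly_ring n)"
  by (intro sum_in_carrier mult_closed_mpoly) auto

lemma lookup_Const_Var_mult:
  "Poly_Mapping.lookup (Const x * Var i * f) u = (if 1 \<le> Poly_Mapping.lookup u i
     then x * Poly_Mapping.lookup f (Abs_poly_mapping
       ((Poly_Mapping.lookup u)(i := Poly_Mapping.lookup u i - 1))) else 0)"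
proof -
  let ?e = "Poly_Mapping.single i (1::nat)"
  have "Const x * Var i * f = Poly_Mapping.single ?e x * f"
    by (simp add: Const_def Var_def mult_single)
  moreover have "Poly_Mapping.lookup (Poly_Mapping.single ?e x * f) u =
      (if 1 \<le> Poly_Mapping.lookup u i then x * Poly_Mapping.lookup f (u - ?e) else 0)"
  proof -
    have *: "u = ?e + q \<longleftrightarrow> 1 \<le> Poly_Mapping.lookup u i \<and> q = u - ?e" for q
    proof
      assume "u = ?e + q"
      then show "1 \<le> Poly_Mapping.lookup u i \<and> q = u - ?e" by (simp add: lookup_add)
    next
      assume "1 \<le> Poly_Mapping.lookup u i \<and> q = u - ?e"
      then show "u = ?e + q"
        by (auto intro!: poly_mapping_eqI simp: lookup_add lookup_minus lookup_single when_def)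
    qed
    have "Poly_Mapping.lookup (Poly_Mapping.single ?e x * f) u
        = x * (\<Sum>q. Poly_Mapping.lookup f q when u = ?e + q)"
      by (simp add: lookup_mult lookup_single when_mult)
    also have "\<dots> = (if 1 \<le> Poly_Mapping.lookup u i then x * Poly_Mapping.lookup f (u - ?e) else 0)"
      unfolding * by auto
    finally show ?thesis .
  qed
  moreover have "u - ?e = Abs_poly_mapping ((Poly_Mapping.lookup u)(i := Poly_Mapping.lookup u i - 1))"
  proof (rule poly_mapping_eqI)
    fix j
    have "finite {j. ((Poly_Mapping.lookup u)(i := Poly_Mapping.lookup u i - 1)) j \<noteq> 0}"
      by (rule finite_subset[of _ "Poly_Mapping.keys u"]) (auto simp: in_keys_iff)
    then show "Poly_Mapping.lookup (u - ?e) j = Poly_Mapping.lookup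
        (Abs_poly_mapping ((Poly_Mapping.lookup u)(i := Poly_Mapping.lookup u i - 1))) j"
      by (simp add: lookup_minus lookup_single when_def)
  qed
  ultimately show ?thesis by simp
qed

lemma lookup_linear_poly_mult:
  "Poly_Mapping.lookup (linear_poly n c * f) u =
     shift {..<n} c 1 (\<lambda>m. Poly_Mapping.lookup f (Abs_poly_mapping m)) (Poly_Mapping.lookup u)"
  unfolding sum_distrib_right lookup_sum lookup_Const_Var_mult shift_def ..

lemma lookup_linear_poly_mult_box_poly:
  assumes u: "u \<in> std_monoms n a"
  shows "Poly_Mapping.lookup (linear_poly n c * box_poly n a d w) u =
    Poly_Mapping.lookup (box_poly n a (Suc d) (shift {..<n} c 1 w)) u"
proof -
  let ?w = "\<lambda>m. Poly_Mapping.lookup (box_poly n a d w) (Abs_poly_mapping m)"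
  have w: "?w m = (if m \<in> box {..<n} a d then w m else 0)" if "finite {i. m i \<noteq> 0}" for m
    using that by (simp add: lookup_box_poly std_monoms_deg_iff)
  show ?thesis
  proof (cases "u \<in> std_monoms_deg n a (Suc d)")
    case True
    then have "shift {..<n} c 1 ?w (Poly_Mapping.lookup u) = shift {..<n} c 1 w (Poly_Mapping.lookup u)"
      using finite_support_box by (intro shift_cong[of _ _ a d]) (auto simp: std_monoms_deg_iff w)
    then show ?thesis using True by (simp add: lookup_linear_poly_mult lookup_box_poly)
  next
    case False
    \<comment> \<open>Off degree d + 1 no neighbour lies in degree d, so both sides vanish.\<close>
    have "?w ((Poly_Mapping.lookup u)(i := Poly_Mapping.lookup u i - 1)) = 0"
      if i: "i < n" "1 \<le> Poly_Mapping.lookup u i" for i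
    proof -
      let ?m = "(Poly_Mapping.lookup u)(i := Poly_Mapping.lookup u i - 1)"
      have "finite {j. ?m j \<noteq> 0}"
        by (rule finite_subset[of _ "Poly_Mapping.keys u"]) (auto simp: in_keys_iff)
      moreover have "sum ?m {..<n} + 1 = (\<Sum>j<n. Poly_Mapping.lookup u j)"
        using sum_fun_upd[of "{..<n}" i "Poly_Mapping.lookup u" "Poly_Mapping.lookup u i - 1"] i by simp
      ultimately show ?thesis
        using False u unfolding std_monoms_deg_def by (auto simp: w box_def)
    qed
    then show ?thesis
      using False unfolding lookup_linear_poly_mult lookup_box_poly shift_def
      by (auto intro!: sum.neutral)
  qed
qed

lemma image_graded_piece:
  "(\<lambda>x. linear_form n a c \<otimes>\<^bsub>mci n a\<^esub> x) ` graded_piece n a d =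
    range (\<lambda>w. mci_class n a (linear_poly n c * box_poly n a d w))"
  unfolding graded_piece_eq linear_form_def by (auto simp: mci_class_mult image_image)

lemma mci_dim_image_iff:
  fixes c :: "nat \<Rightarrow> 'k::field"
  assumes a: "\<And>i. i < n \<Longrightarrow> 1 \<le> a i"
  shows "mci_dim n a ((\<lambda>x. linear_form n a c \<otimes>\<^bsub>mci n a\<^esub> x) ` graded_piece n a d) =
    card (box {..<n} a d) \<longleftrightarrow> lef_inj {..<n} a c d"
proof -
  have eq: "(\<forall>u\<in>std_monoms n a. Poly_Mapping.lookup (linear_poly n c * box_poly n a d w) u = 0) \<longleftrightarrow>
      (\<forall>m\<in>box {..<n} a (Suc d). shift {..<n} c 1 w m = 0)" for w
    unfolding lookup_image_std_monoms_deg[symmetric]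
    by (auto simp: lookup_linear_poly_mult_box_poly lookup_box_poly std_monoms_deg_def)
  have "mci_dim n a (range (\<lambda>w. mci_class n a (linear_poly n c * box_poly n a d w))) =
      card (box {..<n} a d) \<longleftrightarrow>
      (\<forall>w. (\<forall>u\<in>std_monoms n a. Poly_Mapping.lookup (linear_poly n c * box_poly n a d w) u = 0) \<longrightarrow>
        (\<forall>m\<in>box {..<n} a d. w m = 0))"
    by (rule mci_dim_multiples[OF a linear_poly_in_carrier])
  then show ?thesis
    unfolding image_graded_piece eq lef_inj_def .
qed

lemma image_graded_piece_surj:
  fixes c :: "nat \<Rightarrow> 'k::field"
  assumes surj: "\<And>f. \<exists>v. \<forall>m\<in>box {..<n} a (Suc d). shift {..<n} c 1 v m = f m"
  shows "(\<lambda>x. linear_form n a c \<otimes>\<^bsub>mci n a\<^esub> x) ` graded_piece n a d = graded_piece n a (Suc d)"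
proof -
  have eq: "mci_class n a (linear_poly n c * box_poly n a d w) =
      mci_class n a (box_poly n a (Suc d) (shift {..<n} c 1 w))" for w
    by (subst mci_class_eq_iff) (simp_all add: mult_closed_mpoly lookup_linear_poly_mult_box_poly)
  have "\<exists>v. mci_class n a (box_poly n a (Suc d) f) =
      mci_class n a (box_poly n a (Suc d) (shift {..<n} c 1 v))" for f :: "(nat \<Rightarrow> nat) \<Rightarrow> 'k"
  proof -
    obtain v where "\<forall>m\<in>box {..<n} a (Suc d). shift {..<n} c 1 v m = f m" using surj by blast
    then have "box_poly n a (Suc d) f = box_poly n a (Suc d) (shift {..<n} c 1 v)"
      unfolding box_poly_def by (intro sum.cong) (auto simp: std_monoms_deg_iff)
    then show ?thesis by metis
  qed
  then show ?thesis
    unfolding image_graded_piece eq unfolding graded_piece_eq by (auto simp: image_def)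
qed

section \<open>The weak Lefschetz property\<close>

text \<open>In the lower half the map is injective and the Hilbert function increases; in the upper
  half it is surjective by duality, or because the target is zero.\<close>

lemma mult_max_rank_linear_form:
  fixes c :: "nat \<Rightarrow> 'k::field"
  assumes a: "\<And>i. i < n \<Longrightarrow> 1 \<le> a i"
    and inj: "\<And>e. 2 * e + 1 \<le> (\<Sum>i<n. a i - 1) \<Longrightarrow> lef_inj {..<n} a c e"
  shows "mult_max_rank n a (linear_form n a c) d"
proof (cases "2 * d + 1 \<le> (\<Sum>i<n. a i - 1)")
  case True
  have "card (box {..<n} a d) \<le> card (box {..<n} a (Suc d))"
    using a True by (intro card_box_increasing) auto
  moreover have "mci_dim n a ((\<lambda>x. linear_form n a c \<otimes>\<^bsub>mci n a\<^esub> x) ` graded_piece n a d) =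
      card (box {..<n} a d)"
    using inj[OF True] by (subst mci_dim_image_iff[OF a])
  ultimately show ?thesis
    unfolding mult_max_rank_def by (simp add: mci_dim_graded_piece[of n a, OF a])
next
  case False
  have "card (box {..<n} a (Suc d)) \<le> card (box {..<n} a d)"
    using a False by (intro card_box_decreasing) auto
  moreover have "\<exists>v. \<forall>m\<in>box {..<n} a (Suc d). shift {..<n} c 1 v m = f m" for f
  proof (cases "d < (\<Sum>i<n. a i - 1)")
    case True
    \<comment> \<open>The dual degree s - 1 - d, which lies in the lower half because s \<le> 2d +
      1.\<close>
    define e where "e = (\<Sum>i<n. a i - 1) - Suc d"
    have "lef_inj {..<n} a c e" using True False unfolding e_def by (intro inj) linarith
    then show ?thesis
      using True unfolding e_def by (intro lef_inj_imp_dual_surj[of _ d e]) (auto simp: e_def)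
  next
    case False
    have "sum m {..<n} \<le> (\<Sum>i<n. a i - 1)" if "\<forall>i\<in>{..<n}. m i < a i" for m
      using that by (intro sum_mono) force
    then have "box {..<n} a (Suc d) = {}" using False unfolding box_def by fastforce
    then show ?thesis by simp
  qed
  then have "(\<lambda>x. linear_form n a c \<otimes>\<^bsub>mci n a\<^esub> x) ` graded_piece n a d = graded_piece n a (Suc d)"
    by (rule image_graded_piece_surj)
  ultimately show ?thesis
    unfolding mult_max_rank_def by (simp add: mci_dim_graded_piece[of n a, OF a])
qed

text \<open>In the lower half the source has the smaller dimension, so maximal rank would mean
  injectivity.\<close>

lemma not_mult_max_rank_linear_form:
  fixes c :: "nat \<Rightarrow> 'k::field"
  assumes a: "\<And>i. i < n \<Longrightarrow> 1 \<le> a i"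
    and d: "2 * d + 1 \<le> (\<Sum>i<n. a i - 1)" "\<not> lef_inj {..<n} a c d"
  shows "\<not> mult_max_rank n a (linear_form n a c) d"
proof -
  have "card (box {..<n} a d) \<le> card (box {..<n} a (Suc d))"
    using a d by (intro card_box_increasing) auto
  moreover have "mci_dim n a ((\<lambda>x. linear_form n a c \<otimes>\<^bsub>mci n a\<^esub> x) ` graded_piece n a d) \<noteq>
      card (box {..<n} a d)"
    using d(2) by (subst mci_dim_image_iff[OF a])
  ultimately show ?thesis
    unfolding mult_max_rank_def by (simp add: mci_dim_graded_piece[of n a, OF a])
qed

text \<open>T_i is zero in the quotient when a_i = 1, so its coefficient has no influence.\<close>

lemma lef_inj_cong:
  assumes "\<And>i. i \<in> I \<Longrightarrow> 2 \<le> a i \<Longrightarrow> c i = c' i"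
  shows "lef_inj I a c d \<longleftrightarrow> lef_inj I a c' d"
proof -
  have "shift I c 1 v m = shift I c' 1 v m" if m: "m \<in> box I a (Suc d)" for v m
    unfolding shift_def
  proof (intro sum.cong refl)
    fix i assume i: "i \<in> I"
    have "2 \<le> a i" if "1 \<le> m i" using m i that unfolding box_def by force
    then show "(if 1 \<le> m i then c i * v (m(i := m i - 1)) else 0) =
        (if 1 \<le> m i then c' i * v (m(i := m i - 1)) else 0)"
      using assms[OF i] by auto
  qed
  then show ?thesis unfolding lef_inj_def by simp
qed

lemma lookup_linear_poly:
  "Poly_Mapping.lookup (linear_poly n c) u = (\<Sum>i<n. if u = Poly_Mapping.single i 1 then c i else 0)"
  by (auto simp: lookup_sum Const_def Var_def mult_single lookup_single when_def intro!: sum.cong)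

lemma single_one_eq_iff: "Poly_Mapping.single i (1::nat) = Poly_Mapping.single j 1 \<longleftrightarrow> i = j"
  by (metis lookup_single_eq lookup_single_not_eq zero_neq_one)

lemma lookup_linear_poly_single:
  "i < n \<Longrightarrow> Poly_Mapping.lookup (linear_poly n c) (Poly_Mapping.single i 1) = c i"
  unfolding lookup_linear_poly single_one_eq_iff by simp

lemma degree_one_monomial:
  fixes u :: "nat \<Rightarrow>\<^sub>0 nat"
  assumes "Poly_Mapping.keys u \<subseteq> {..<n}" "(\<Sum>i<n. Poly_Mapping.lookup u i) = 1"
  obtains i where "i < n" "u = Poly_Mapping.single i 1"
proof -
  obtain i where i: "i < n" "Poly_Mapping.lookup u i = 1"
    "\<And>j. j < n \<Longrightarrow> i \<noteq> j \<Longrightarrow> Poly_Mapping.lookup u j = 0"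
    using assms(2) sum_eq_1_iff[of "{..<n}" "Poly_Mapping.lookup u"] by auto
  have "Poly_Mapping.lookup u j = 0" if "\<not> j < n" for j
    using assms(1) that by (auto simp: in_keys_iff)
  then have "u = Poly_Mapping.single i 1"
    using i by (intro poly_mapping_eqI) (auto simp: lookup_single when_def)
  then show ?thesis using that i(1) by blast
qed

lemma linear_form_in_graded_piece: "linear_form n a c \<in> graded_piece n a 1"
proof -
  have "homogeneous 1 (linear_poly n c)"
    unfolding homogeneous_iff[OF linear_poly_in_carrier]
  proof
    fix u assume "u \<in> Poly_Mapping.keys (linear_poly n c)"
    then have "\<exists>i<n. u = Poly_Mapping.single i 1"
      unfolding in_keys_iff lookup_linear_poly by (force intro: sum.neutral)
    then show "(\<Sum>i<n. Poly_Mapping.lookup u i) = 1"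
      by (auto simp: lookup_single when_def)
  qed
  then show ?thesis by (auto simp: linear_form_def graded_piece_def)
qed

lemma graded_piece_one:
  assumes "l \<in> graded_piece n a 1"
  obtains c :: "nat \<Rightarrow> 'k::field" where "l = linear_form n a c"
proof -
  obtain f :: "'k mpoly" where f: "f \<in> carrier (mpoly_ring n)" "homogeneous 1 f" "l = mci_class n a f"
    using assms by (auto simp: graded_piece_def)
  define c where "c i = Poly_Mapping.lookup f (Poly_Mapping.single i 1)" for i
  have "Poly_Mapping.lookup f u = Poly_Mapping.lookup (linear_poly n c) u" for u
  proof (cases "\<exists>i<n. u = Poly_Mapping.single i 1")
    case True
    then obtain i where i: "i < n" "u = Poly_Mapping.single i 1" by blast
    show ?thesis unfolding i(2) lookup_linear_poly_single[OF i(1)] c_def ..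
  next
    case False
    have "u \<notin> Poly_Mapping.keys f"
    proof
      assume u: "u \<in> Poly_Mapping.keys f"
      then have "Poly_Mapping.keys u \<subseteq> {..<n}" "(\<Sum>i<n. Poly_Mapping.lookup u i) = 1"
        using f homogeneous_iff[OF f(1)] by (auto simp: carrier_mpoly_ring)
      then show False using False by (elim degree_one_monomial) auto
    qed
    then show ?thesis
      using False unfolding lookup_linear_poly by (auto simp: in_keys_iff intro!: sum.neutral[symmetric])
  qed
  then have "f = linear_poly n c" by (rule poly_mapping_eqI)
  then show ?thesis using f(3) that by (simp add: linear_form_def)
qed

text \<open>The open set is a principal one: the product of the coefficients of the variables that
  survive in the quotient is nonzero.\<close>

lemma weak_lefschetz_property_if_lef_inj:
  assumes a: "\<And>i. i < n \<Longrightarrow> 1 \<le> a i"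
    and inj: "\<And>(c :: nat \<Rightarrow> 'k::field) d. (\<And>i. i < n \<Longrightarrow> c i \<noteq> 0) \<Longrightarrow>
      2 * d + 1 \<le> (\<Sum>i<n. a i - 1) \<Longrightarrow> lef_inj {..<n} a c d"
  shows "weak_lefschetz_property TYPE('k) n a"
proof -
  define J where "J = {i. i < n \<and> 2 \<le> a i}"
  have finJ: "finite J" unfolding J_def by simp
  \<comment> \<open>\<open>T\<^sub>i\<close> vanishes in the quotient if \<open>a\<^sub>i = 1\<close>, so \<open>c\<^sub>i\<close> can only be constrained if \<open>a\<^sub>i \<ge> 2\<close>.\<close>
  define U :: "'k mpoly set set" where "U = linear_form n a ` {c. \<forall>i\<in>J. c i \<noteq> 0}"
  define e where "e = (\<Sum>i\<in>J. Poly_Mapping.single i (1::nat))"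
  \<comment> \<open>\<open>F\<close> is the product of the T_i with i in \<open>J\<close>, so its
    value at c is the product of the corresponding c_i.\<close>
  define F :: "'k mpoly" where "F = Poly_Mapping.single e 1"
  have e: "Poly_Mapping.lookup e i = (if i \<in> J then 1 else 0)" for i
    unfolding e_def lookup_sum using finJ by (simp add: lookup_single when_def)
  have keys: "Poly_Mapping.keys e = J" by (auto simp: in_keys_iff e split: if_splits)
  have eval: "mpoly_eval c F \<noteq> 0 \<longleftrightarrow> (\<forall>i\<in>J. c i \<noteq> 0)" for c
    unfolding mpoly_eval_def F_def using finJ by (simp add: keys e)
  have coeff: "c i = c' i" if eq: "linear_form n a c = linear_form n a c'" and i: "i \<in> J"
    for c c' :: "nat \<Rightarrow> 'k" and i
  proof -
    have "Poly_Mapping.single i 1 \<in> std_monoms n a"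
      using i a unfolding J_def std_monoms_def
      by (auto simp: lookup_single when_def) (meson Suc_le_lessD)+
    then have "Poly_Mapping.lookup (linear_poly n c) (Poly_Mapping.single i 1) =
        Poly_Mapping.lookup (linear_poly n c') (Poly_Mapping.single i 1)"
      using eq unfolding linear_form_def by (simp add: mci_class_eq_iff)
    moreover have "i < n" using i unfolding J_def by simp
    ultimately show ?thesis by (simp only: lookup_linear_poly_single)
  qed
  have "linear_form n a c \<in> U \<longleftrightarrow> mpoly_eval c F \<noteq> 0" for c
    unfolding eval
  proof
    assume "linear_form n a c \<in> U"
    then obtain c' where "linear_form n a c = linear_form n a c'" "\<forall>i\<in>J. c' i \<noteq> 0"
      unfolding U_def by blast
    then show "\<forall>i\<in>J. c i \<noteq> 0" using coeff[of c c'] by simp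
  next
    assume "\<forall>i\<in>J. c i \<noteq> 0"
    then show "linear_form n a c \<in> U" unfolding U_def by blast
  qed
  moreover have "F \<in> carrier (mpoly_ring n)"
    unfolding F_def by (rule single_in_carrier) (auto simp: keys J_def)
  moreover have "U \<subseteq> graded_piece n a 1"
    unfolding U_def using linear_form_in_graded_piece by blast
  ultimately have "zariski_open n a U"
    unfolding zariski_open_def by (intro conjI exI[of _ "{F}"]) auto
  moreover have "U \<noteq> {}"
    unfolding U_def by (auto intro: exI[of _ "\<lambda>_. 1"])
  moreover have "weak_lefschetz_element n a l" if l: "l \<in> U" for l
  proof -
    obtain c where c: "l = linear_form n a c" "\<forall>i\<in>J. c i \<noteq> 0" using l unfolding U_def by blast
    \<comment> \<open>Coefficients outside \<open>J\<close> may vanish; replacing them by 1 makes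
      the hypothesis applicable without changing injectivity.\<close>
    define c' where "c' i = (if i \<in> J then c i else 1)" for i
    have "lef_inj {..<n} a c d" if "2 * d + 1 \<le> (\<Sum>i<n. a i - 1)" for d
    proof -
      have "lef_inj {..<n} a c' d" using c(2) that by (intro inj) (auto simp: c'_def)
      then show ?thesis
        using lef_inj_cong[of "{..<n}" a c c' d] by (simp add: c'_def J_def)
    qed
    then show ?thesis
      unfolding weak_lefschetz_element_def c(1)
      using mult_max_rank_linear_form[of n a c, OF a] linear_form_in_graded_piece by blast
  qed
  ultimately show ?thesis unfolding weak_lefschetz_property_def by blast
qed

text \<open>A nonempty open set contains some linear form, and none is a Weak Lefschetz
  element.\<close>

lemma not_weak_lefschetz_property_if_not_lef_inj:
  assumes a: "\<And>i. i < n \<Longrightarrow> 1 \<le> a i"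
    and "\<And>c :: nat \<Rightarrow> 'k::field. \<exists>d. 2 * d + 1 \<le> (\<Sum>i<n. a i - 1) \<and> \<not> lef_inj {..<n} a c d"
  shows "\<not> weak_lefschetz_property TYPE('k) n a"
proof
  assume "weak_lefschetz_property TYPE('k) n a"
  then obtain l :: "'k mpoly set" where l: "weak_lefschetz_element n a l"
    unfolding weak_lefschetz_property_def by blast
  then obtain c where c: "l = linear_form n a c"
    using graded_piece_one[of l n a] unfolding weak_lefschetz_element_def by blast
  obtain d where "2 * d + 1 \<le> (\<Sum>i<n. a i - 1)" "\<not> lef_inj {..<n} a c d"
    using assms(2) by blast
  then have "\<not> mult_max_rank n a (linear_form n a c) d"
    by (intro not_mult_max_rank_linear_form a)
  then show False using l unfolding c weak_lefschetz_element_def by blast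
qed

theorem theorem1p5:
  fixes n p s :: nat
  assumes "CHAR('k::alg_closed_field) = p" and "p > 0" and "n \<ge> 3"
  shows "(\<forall>a :: nat \<Rightarrow> nat. (\<forall>i<n. 1 \<le> a i) \<and> (\<Sum>i<n. a i) = s + n
            \<longrightarrow> weak_lefschetz_property TYPE('k) n a)
     \<longleftrightarrow> s \<le> 2 * p - 2
       \<or> n = 3 \<and> (\<exists>t q k :: nat. 1 \<le> t \<and> t < p \<and> q = p ^ k \<and> q \<ge> p
                    \<and> (2 * t + 2) * q - 4 \<le> s \<and> s \<le> (2 * t + 2) * q - 2)
       \<or> n = 4 \<and> p = 2 \<and> s = 6"
    (is "?wlp \<longleftrightarrow> ?cond")
proof -
  have p: "Factorial_Ring.prime p" "p = CHAR('k)"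
    using prime_CHAR_semidom[where 'a = 'k] assms(1,2) by auto
  have s: "(\<Sum>i<n. a i - 1) = s" if "\<And>i. i < n \<Longrightarrow> 1 \<le> a i" "(\<Sum>i<n. a i) = s + n" for a
    using sum_pred[of "{..<n}" a] that by simp
  show ?thesis
  proof
    assume ?cond
    show ?wlp
    proof (intro allI impI)
      fix a :: "nat \<Rightarrow> nat"
      assume a: "(\<forall>i<n. 1 \<le> a i) \<and> (\<Sum>i<n. a i) = s + n"
      then have a1: "1 \<le> a i" if "i < n" for i using that by blast
      show "weak_lefschetz_property TYPE('k) n a"
      proof (rule weak_lefschetz_property_if_lef_inj[OF a1])
        fix c :: "nat \<Rightarrow> 'k" and d
        assume "\<And>i. i < n \<Longrightarrow> c i \<noteq> 0" "2 * d + 1 \<le> (\<Sum>i<n. a i - 1)"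
        then show "lef_inj {..<n} a c d"
          using a s[of a] by (intro lef_inj_of_socle_degree[OF p _ _ _ _ \<open>?cond\<close>]) auto
      qed
    qed
  next
    assume wlp: ?wlp
    show ?cond
    proof (rule ccontr)
      assume not: "\<not> ?cond"
      then obtain a where a: "\<forall>i<n. 1 \<le> a i" "(\<Sum>i<n. a i) = s + n"
        and fail: "\<And>c :: nat \<Rightarrow> 'k. \<exists>d. 2 * d + 1 \<le> s \<and> \<not> lef_inj {..<n} a c d"
        using exists_not_lef_inj[OF assms(3) p, of s] by blast
      have "\<not> weak_lefschetz_property TYPE('k) n a"
      proof (rule not_weak_lefschetz_property_if_not_lef_inj)
        show "1 \<le> a i" if "i < n" for i using a(1) that by blast
        show "\<exists>d. 2 * d + 1 \<le> (\<Sum>i<n. a i - 1) \<and> \<not> lef_inj {..<n} a c d" for c :: "nat \<Rightarrow> 'k"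
          using fail[of c] s[of a] a by simp
      qed
      then show False using wlp a by blast
    qed
  qed
qed

end
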